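(* Let $n\ge 2$ and let $\Omega\subset\mathbb R^n$ be a bounded convex domain with $C^2$ boundary. Let $q_1,q_2\in C^2(\overline\Omega)$ satisfy $q_j\ge c_0>0$ for a constant $c_0$, $j=1,2$, and fix $b>R_\Omega:=\sup_{x\in\overline\Omega}|x|$. For $e\in\mathbb S^{n-1}$ set $\ell_{e,b}(x)=e\cdot x+b$. Suppose that, for every $e\in\mathbb S^{n-1}$, there is $t_e>0$ such that $$\Lambda_{q_1}\bigl(t\ell_{e,b}|_{\partial\Omega}\bigr)=\Lambda_{q_2}\bigl(t\ell_{e,b}|_{\partial\Omega}\bigr)\quad\text{on }\partial\Omega$$ for all $t\ge t_e$. Then $q_1=q_2$ in $\Omega$.
   Context: The infinity Laplacian is $\Delta_\infty u=\langle D^2u\,Du,Du\rangle=\sum_{i,j}u_{x_i}u_{x_j}u_{x_ix_j}$. Set $F_q(x,r,p,X)=-p^TXp+q(x)r$. A function $u\in C(\Omega)$ is a viscosity subsolution (resp. supersolution) of $-\Delta_\infty u+qu=0$ in $\Omega$ if, whenever $\phi\in C^2(\Omega)$ and $u-\phi$ has a local maximum (resp. minimum) at $x_0\in\Omega$, one has $F_q(x_0,u(x_0),D\phi(x_0),D^2\phi(x_0))\le 0$ (resp. $\ge 0$); a viscosity solution is both. For $f\in C(\partial\Omega)$, $u_f^q\in C(\overline\Omega)$ denotes the unique viscosity solution of $-\Delta_\infty u+q(x)u=0$ in $\Omega$ with $u=f$ pointwise on $\partial\Omega$. A function $u\in C(\overline\Omega)$ is differentiable at $x_0\in\partial\Omega$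 if there is a vector $Du(x_0)\in\mathbb R^n$ with $u(x)=u(x_0)+Du(x_0)\cdot(x-x_0)+o(|x-x_0|)$ as $x\to x_0$ within $\overline\Omega$. For $f\in C^1(\partial\Omega)$ the solution $u_f^q$ is differentiable at every boundary point, and the Dirichlet-to-Neumann map is $\Lambda_q(f)(x)=Du_f^q(x)\cdot\nu(x)$, $x\in\partial\Omega$, where $\nu$ is the outward unit normal. *)

theory Defs
  imports "HOL-Analysis.Analysis"
begin

text \<open>
  \<open>C2_with S f Df D2f\<close>, for open \<open>S\<close>: \<open>f\<close> is twice continuously differentiable on \<open>S\<close>, with
  gradient \<open>Df\<close> and Hessian matrix \<open>D2f\<close>.
\<close>

definition C2_with ::
  "(real ^ 'n) set \<Rightarrow> (real ^ 'n \<Rightarrow> real) \<Rightarrow> (real ^ 'n \<Rightarrow> real ^ 'n) \<Rightarrow>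
   (real ^ 'n \<Rightarrow> real ^ 'n ^ 'n) \<Rightarrow> bool" where
  "C2_with S f Df D2f \<longleftrightarrow>
     (\<forall>x\<in>S. GDERIV f x :> Df x) \<and>
     (\<forall>x\<in>S. (Df has_derivative (\<lambda>h. D2f x *v h)) (at x)) \<and>
     continuous_on S D2f"

text \<open>
  The space \<open>C\<^sup>2\<close> of the closure of an open set \<open>\<Omega>\<close>: all derivatives of order at most two exist
  in \<open>\<Omega>\<close> and extend continuously to the closure.
\<close>

definition C2_closure :: "(real ^ 'n) set \<Rightarrow> (real ^ 'n \<Rightarrow> real) \<Rightarrow> bool" where
  "C2_closure \<Omega> f \<longleftrightarrow>
     (\<exists>Df D2f. C2_with \<Omega> f Df D2f \<and> continuous_on (closure \<Omega>) f \<and>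
        continuous_on (closure \<Omega>) Df \<and> continuous_on (closure \<Omega>) D2f)"

text \<open>
  \<open>C\<^sup>2\<close> boundaries and normals are expressed by local defining functions, negative inside \<open>\<Omega>\<close>
  and without critical points, so that their gradient at a boundary point is a positive multiple
  of the outward normal there.
\<close>

definition local_defining_function ::
  "(real ^ 'n) set \<Rightarrow> real ^ 'n \<Rightarrow> (real ^ 'n) set \<Rightarrow> (real ^ 'n \<Rightarrow> real) \<Rightarrow>
   (real ^ 'n \<Rightarrow> real ^ 'n) \<Rightarrow> bool" where
  "local_defining_function \<Omega> x U \<rho> D\<rho> \<longleftrightarrow>
     open U \<and> x \<in> U \<and> (\<exists>D2\<rho>. C2_with U \<rho> D\<rho> D2\<rho>) \<and> (\<forall>y\<in>U. D\<rho> y \<noteq> 0) \<and>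
     \<Omega> \<inter> U = {y \<in> U. \<rho> y < 0}"

definition C2_boundary :: "(real ^ 'n) set \<Rightarrow> bool" where
  "C2_boundary \<Omega> \<longleftrightarrow> (\<forall>x\<in>frontier \<Omega>. \<exists>U \<rho> D\<rho>. local_defining_function \<Omega> x U \<rho> D\<rho>)"

definition outward_unit_normal :: "(real ^ 'n) set \<Rightarrow> real ^ 'n \<Rightarrow> real ^ 'n" where
  "outward_unit_normal \<Omega> x =
     (THE \<nu>. \<exists>U \<rho> D\<rho>. local_defining_function \<Omega> x U \<rho> D\<rho> \<and> \<nu> = D\<rho> x /\<^sub>R norm (D\<rho> x))"

definition F_op ::
  "(real ^ 'n \<Rightarrow> real) \<Rightarrow> real ^ 'n \<Rightarrow> real \<Rightarrow> real ^ 'n \<Rightarrow> real ^ 'n ^ 'n \<Rightarrow> real" where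
  "F_op q x r p X = - (p \<bullet> (X *v p)) + q x * r"

definition viscosity_subsolution ::
  "(real ^ 'n) set \<Rightarrow> (real ^ 'n \<Rightarrow> real) \<Rightarrow> (real ^ 'n \<Rightarrow> real) \<Rightarrow> bool" where
  "viscosity_subsolution \<Omega> q u \<longleftrightarrow> continuous_on \<Omega> u \<and>
     (\<forall>\<phi> D\<phi> D2\<phi>. \<forall>x\<^sub>0\<in>\<Omega>. C2_with \<Omega> \<phi> D\<phi> D2\<phi> \<longrightarrow>
        (\<forall>\<^sub>F x in at x\<^sub>0 within \<Omega>. u x - \<phi> x \<le> u x\<^sub>0 - \<phi> x\<^sub>0) \<longrightarrow>
        F_op q x\<^sub>0 (u x\<^sub>0) (D\<phi> x\<^sub>0) (D2\<phi> x\<^sub>0) \<le> 0)"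

definition viscosity_supersolution ::
  "(real ^ 'n) set \<Rightarrow> (real ^ 'n \<Rightarrow> real) \<Rightarrow> (real ^ 'n \<Rightarrow> real) \<Rightarrow> bool" where
  "viscosity_supersolution \<Omega> q u \<longleftrightarrow> continuous_on \<Omega> u \<and>
     (\<forall>\<phi> D\<phi> D2\<phi>. \<forall>x\<^sub>0\<in>\<Omega>. C2_with \<Omega> \<phi> D\<phi> D2\<phi> \<longrightarrow>
        (\<forall>\<^sub>F x in at x\<^sub>0 within \<Omega>. u x - \<phi> x \<ge> u x\<^sub>0 - \<phi> x\<^sub>0) \<longrightarrow>
        F_op q x\<^sub>0 (u x\<^sub>0) (D\<phi> x\<^sub>0) (D2\<phi> x\<^sub>0) \<ge> 0)"

definition viscosity_solution ::
  "(real ^ 'n) set \<Rightarrow> (real ^ 'n \<Rightarrow> real) \<Rightarrow> (real ^ 'n \<Rightarrow> real) \<Rightarrow> bool" where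
  "viscosity_solution \<Omega> q u \<longleftrightarrow> viscosity_subsolution \<Omega> q u \<and> viscosity_supersolution \<Omega> q u"

definition dirichlet_solution ::
  "(real ^ 'n) set \<Rightarrow> (real ^ 'n \<Rightarrow> real) \<Rightarrow> (real ^ 'n \<Rightarrow> real) \<Rightarrow> (real ^ 'n \<Rightarrow> real) \<Rightarrow> bool" where
  "dirichlet_solution \<Omega> q f u \<longleftrightarrow>
     continuous_on (closure \<Omega>) u \<and> viscosity_solution \<Omega> q u \<and> (\<forall>x\<in>frontier \<Omega>. u x = f x)"

text \<open>
  The Dirichlet-to-Neumann map, as a relation between Dirichlet data \<open>f\<close> and Neumann data \<open>g\<close>
  (in the manner of \<^const>\<open>has_integral\<close>): it is the graph of \<open>\<Lambda>\<^sub>q\<close>, because the solution with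
  data \<open>f\<close> is unique. Only the values of \<open>f\<close> and \<open>g\<close> on the boundary matter.
\<close>

definition has_DN_data ::
  "(real ^ 'n) set \<Rightarrow> (real ^ 'n \<Rightarrow> real) \<Rightarrow> (real ^ 'n \<Rightarrow> real) \<Rightarrow> (real ^ 'n \<Rightarrow> real) \<Rightarrow> bool" where
  "has_DN_data \<Omega> q f g \<longleftrightarrow>
     (\<exists>u Du. dirichlet_solution \<Omega> q f u \<and>
        (\<forall>x\<in>frontier \<Omega>. (u has_derivative (\<lambda>h. Du x \<bullet> h)) (at x within closure \<Omega>) \<and>
           g x = Du x \<bullet> outward_unit_normal \<Omega> x))"

definition ell :: "real ^ 'n \<Rightarrow> real \<Rightarrow> real ^ 'n \<Rightarrow> real" where
  "ell e b x = e \<bullet> x + b"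

end

theory Submission
  imports Defs
begin

text \<open>
  Write \<open>\<ell> = e \<bullet> x + b\<close> and let \<open>u\<close> be the solution with boundary values \<open>t \<ell>\<close>. The equation is
  cubic in \<open>u\<close> on one side and linear on the other, so for large \<open>t\<close> the solution is \<open>t \<ell> + v / t\<close>
  up to lower order, where \<open>v\<close> solves the linearisation of the infinity Laplacian at \<open>\<ell>\<close>, that
  is, the ordinary differential equation \<open>\<partial>\<^sub>e\<partial>\<^sub>e v = q \<ell>\<close> with zero end values on each chord of
  \<open>\<Omega>\<close> in direction \<open>e\<close>. As \<open>v\<close> vanishes on the boundary, its gradient there is normal, so the
  Neumann data of \<open>u\<close> determine \<open>\<partial>\<^sub>e v\<close> at both ends of the chord, and the difference of these
  two slopes is the integral of \<open>q \<ell>\<close> over the chord.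

  To make this rigorous without regularity of \<open>v\<close>, a single chord with end points \<open>p\<close> and
  \<open>p + L e\<close> is fixed. The function \<open>v\<close> is replaced by a globally smooth barrier \<open>V\<close>, built from a
  one-dimensional profile \<open>h\<close> along the axis with \<open>h''\<close> slightly smaller than \<open>q \<ell>\<close>, a tilt
  that makes the gradient of \<open>V\<close> normal at the two ends, and a term quadratic in the distance \<open>d\<close>
  from the axis, \<open>(K - A s\<^sup>2 / 2) d\<^sup>2\<close> with \<open>s\<close> the coordinate along the axis
  (\<open>chord_barrier\<close>). A large \<open>A\<close> forces \<open>\<partial>\<^sub>e\<partial>\<^sub>e V < q \<ell>\<close> on all of \<open>\<Omega>\<close>, and then a large
  \<open>K\<close> forces \<open>V \<ge> 0\<close> on all of the boundary: the line through the chord meets the boundary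
  only at its ends, where it crosses it transversally because \<open>\<Omega>\<close> is convex, and there the
  \<open>C\<^sup>2\<close> boundary deviates from its tangent plane by at most a multiple of \<open>d\<^sup>2\<close>. Comparing the
  viscosity solution with the twice differentiable function \<open>t \<ell> + V / t\<close> needs no doubling of
  variables (\<open>solution_le_first_order_barrier\<close>), and since the two agree at the ends of the chord,
  their normal derivatives are ordered (\<open>DN_lower_bound_at_chord_ends\<close>). The symmetry
  \<open>u \<mapsto> - u\<close> of the equation gives the opposite bound, so equal Neumann data force equal
  integrals of \<open>q \<ell>\<close> over every chord (\<open>chord_integral_le\<close>).

  It remains to invert the ray transform. For \<open>w\<close> orthogonal to \<open>e\<close> the function \<open>exp (w \<bullet> x)\<close>
  is constant along chords in direction \<open>e\<close>, so \<open>(q\<^sub>1 - q\<^sub>2) \<ell> exp (w \<bullet> x)\<close> has integral zero over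
  \<open>\<Omega>\<close>. Adding the identities for \<open>e\<close> and \<open>- e\<close> replaces \<open>\<ell>\<close> by the constant \<open>2 b\<close>, and in
  dimension at least two every \<open>w\<close> is orthogonal to some \<open>e\<close>. Thus all exponential moments of
  \<open>q\<^sub>1 - q\<^sub>2\<close> vanish, and exponential sums are dense by the Stone--Weierstrass theorem
  (\<open>eq_0_if_exponential_moments_eq_0\<close>).
\<close>

section \<open>Comparison of a viscosity solution with a first order barrier\<close>

text \<open>
  A twice differentiable supersolution is itself an admissible test function at an interior maximum
  of \<open>u - \<psi>\<close>. If that maximum were positive, monotonicity of the equation in its zeroth order
  term would contradict the subsolution property; here \<open>q > 0\<close> enters.
\<close>

lemma subsolution_le_C2_supersolution:
  fixes \<Omega> :: "(real ^ 'n) set"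
  assumes "bounded \<Omega>"
    and sub: "viscosity_subsolution \<Omega> q u" and u: "continuous_on (closure \<Omega>) u"
    and q: "\<And>x. x \<in> \<Omega> \<Longrightarrow> q x > 0"
    and C2: "C2_with \<Omega> \<psi> D\<psi> D2\<psi>" and \<psi>: "continuous_on (closure \<Omega>) \<psi>"
    and op: "open \<Omega>"
    and bd: "\<And>x. x \<in> frontier \<Omega> \<Longrightarrow> u x \<le> \<psi> x"
    and super: "\<And>x. x \<in> \<Omega> \<Longrightarrow> D\<psi> x \<bullet> (D2\<psi> x *v D\<psi> x) \<le> q x * \<psi> x"
    and "y \<in> closure \<Omega>"
  shows "u y \<le> \<psi> y"
proof (rule ccontr)
  assume "\<not> u y \<le> \<psi> y"
  have "compact (closure \<Omega>)" "closure \<Omega> \<noteq> {}"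
    using assms by auto
  moreover have "continuous_on (closure \<Omega>) (\<lambda>x. u x - \<psi> x)"
    by (intro continuous_intros u \<psi>)
  ultimately obtain m where m: "m \<in> closure \<Omega>" "\<And>x. x \<in> closure \<Omega> \<Longrightarrow> u x - \<psi> x \<le> u m - \<psi> m"
    using continuous_attains_sup[of "closure \<Omega>" "\<lambda>x. u x - \<psi> x"] by auto
  have pos: "u m > \<psi> m"
    using m(2)[OF assms(10)] \<open>\<not> u y \<le> \<psi> y\<close> by simp
  have "m \<in> \<Omega>"
    using bd[of m] pos m(1) op by (auto simp: frontier_def interior_open)
  have "\<forall>\<^sub>F x in at m within \<Omega>. u x - \<psi> x \<le> u m - \<psi> m"
    unfolding eventually_at_filter using m(2) closure_subset[of \<Omega>] by (intro always_eventually) auto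
  with sub C2 \<open>m \<in> \<Omega>\<close> have "F_op q m (u m) (D\<psi> m) (D2\<psi> m) \<le> 0"
    unfolding viscosity_subsolution_def by blast
  moreover have "q m * \<psi> m < q m * u m"
    using q[OF \<open>m \<in> \<Omega>\<close>] pos by simp
  ultimately show False
    using super[OF \<open>m \<in> \<Omega>\<close>] by (simp add: F_op_def)
qed

lemma C2_withI:
  assumes f: "\<And>x. x \<in> S \<Longrightarrow> GDERIV f x :> Df x"
    and Df: "\<And>x. x \<in> S \<Longrightarrow> (Df has_derivative B x) (at x)"
    and B: "\<And>k. continuous_on S (\<lambda>x. B x k)"
  shows "C2_with S f Df (\<lambda>x. matrix (B x))"
  unfolding C2_with_def
proof (intro conjI ballI f)
  show "(Df has_derivative (\<lambda>h. matrix (B x) *v h)) (at x)" if "x \<in> S" for x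
    using Df[OF that] matrix_vector_mul(2)[OF has_derivative_linear[OF Df[OF that]]] by simp
  show "continuous_on S (\<lambda>x. matrix (B x))"
    unfolding matrix_def by (intro continuous_intros B)
qed

lemma C2_with_subset: "C2_with T f Df D2f \<Longrightarrow> S \<subseteq> T \<Longrightarrow> C2_with S f Df D2f"
  unfolding C2_with_def by (meson continuous_on_subset subset_iff)

lemma C2_with_continuous:
  assumes "C2_with S f Df D2f"
  shows "continuous_on S f" "continuous_on S Df" "continuous_on S D2f"
  using assms unfolding C2_with_def gderiv_def
  by (auto intro!: continuous_at_imp_continuous_on has_derivative_continuous)

lemma C2_affine_plus_scaled:
  fixes V :: "real ^ 'n \<Rightarrow> real"
  assumes "C2_with S V DV D2V"
  shows "C2_with S (\<lambda>x. t * ell e b x + s * V x) (\<lambda>x. t *\<^sub>R e + s *\<^sub>R DV x) (\<lambda>x. s *\<^sub>R D2V x)"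
  unfolding C2_with_def
proof (intro conjI ballI)
  fix x assume x: "x \<in> S"
  have V: "(V has_derivative (\<lambda>h. h \<bullet> DV x)) (at x)"
      "(DV has_derivative (\<lambda>h. D2V x *v h)) (at x)"
    using assms x by (auto simp: C2_with_def gderiv_def inner_commute)
  show "GDERIV (\<lambda>x. t * ell e b x + s * V x) x :> t *\<^sub>R e + s *\<^sub>R DV x"
    unfolding gderiv_def ell_def
    by (rule V derivative_eq_intros refl)+
       (simp add: fun_eq_iff inner_commute algebra_simps)
  show "((\<lambda>x. t *\<^sub>R e + s *\<^sub>R DV x) has_derivative (*v) (s *\<^sub>R D2V x)) (at x)"
    by (rule V derivative_eq_intros refl)+
       (simp add: fun_eq_iff scaleR_matrix_vector_assoc)
next
  show "continuous_on S (\<lambda>x. s *\<^sub>R D2V x)"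
    by (intro continuous_intros C2_with_continuous[OF assms])
qed

text \<open>
  For \<open>\<psi> = t \<ell> + V / t\<close> the infinity Laplacian is \<open>t \<partial>\<^sub>e\<partial>\<^sub>e V + O(1 / t)\<close> while
  \<open>q \<psi> = t q \<ell> + O(1 / t)\<close>. The gap \<open>\<delta>\<close> between the leading terms, multiplied by \<open>t\<close>, beats the
  remainders for large \<open>t\<close>, uniformly on the bounded set \<open>\<Omega>\<close>.
\<close>

lemma solution_le_first_order_barrier:
  fixes \<Omega> :: "(real ^ 'n) set"
  assumes op: "open \<Omega>" and bounded: "bounded \<Omega>"
    and q: "continuous_on (closure \<Omega>) q" "\<And>x. x \<in> \<Omega> \<Longrightarrow> q x > 0"
    and V: "C2_with UNIV V DV D2V" and "\<delta> > 0"
    and ee: "\<And>x. x \<in> \<Omega> \<Longrightarrow> e \<bullet> (D2V x *v e) \<le> q x * ell e b x - \<delta>"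
    and bd: "\<And>x. x \<in> frontier \<Omega> \<Longrightarrow> V x \<ge> 0"
  shows "\<exists>T>0. \<forall>t\<ge>T. \<forall>u. dirichlet_solution \<Omega> q (\<lambda>x. t * ell e b x) u \<longrightarrow>
           (\<forall>x\<in>closure \<Omega>. u x \<le> t * ell e b x + V x / t)"
proof -
  have bounded_on_closure: "\<exists>M>0. \<forall>x\<in>closure \<Omega>. \<bar>f x\<bar> \<le> M"
    if "continuous_on (closure \<Omega>) f" for f :: "real ^ 'n \<Rightarrow> real"
    using compact_imp_bounded[OF compact_continuous_image[OF that]] bounded
    by (auto simp: bounded_pos)
  note cont = C2_with_continuous[OF V, THEN continuous_on_subset, OF subset_UNIV, of "closure \<Omega>"]
  have cmv: "continuous_on (closure \<Omega>) (\<lambda>x. D2V x *v w x)"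
    if "continuous_on (closure \<Omega>) w" for w
    unfolding matrix_vector_mult_def by (intro continuous_intros cont that)
  \<comment> \<open>\<open>E\<close> dominates the coefficients of all remainder terms.\<close>
  define E where "E x = \<bar>e \<bullet> (D2V x *v DV x)\<bar> + \<bar>DV x \<bullet> (D2V x *v e)\<bar>
      + \<bar>DV x \<bullet> (D2V x *v DV x)\<bar> + \<bar>q x * V x\<bar>" for x
  have "continuous_on (closure \<Omega>) E"
    unfolding E_def by (intro continuous_intros cmv cont q(1))
  then obtain M where "M > 0" and M: "\<And>x. x \<in> closure \<Omega> \<Longrightarrow> E x \<le> M"
    using bounded_on_closure[of E] by force
  define T where "T = max 1 (M / \<delta>)"
  show ?thesis
  proof (intro exI[of _ T] conjI allI impI ballI)
    show "T > 0" by (simp add: T_def)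
    fix t u y
    assume t: "t \<ge> T" and u: "dirichlet_solution \<Omega> q (\<lambda>x. t * ell e b x) u" and y: "y \<in> closure \<Omega>"
    have t1: "t \<ge> 1" "t \<ge> M / \<delta>"
      using t by (auto simp: T_def)
    have "u y \<le> t * ell e b y + (1/t) * V y"
    proof (rule subsolution_le_C2_supersolution[OF bounded _ _ q(2)
          C2_affine_plus_scaled[OF C2_with_subset[OF V subset_UNIV]] _ op _ _ y])
      show "viscosity_subsolution \<Omega> q u" "continuous_on (closure \<Omega>) u"
        using u by (auto simp: dirichlet_solution_def viscosity_solution_def)
      show "continuous_on (closure \<Omega>) (\<lambda>x. t * ell e b x + 1 / t * V x)"
        unfolding ell_def by (intro continuous_intros cont)
      show "u x \<le> t * ell e b x + 1 / t * V x" if "x \<in> frontier \<Omega>" for x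
        using u that bd[OF that] t1 by (simp add: dirichlet_solution_def)
      fix x assume x: "x \<in> \<Omega>"
      then have x': "x \<in> closure \<Omega>" using closure_subset by auto
      let ?e2 = "e \<bullet> (D2V x *v e)" and ?e1 = "e \<bullet> (D2V x *v DV x) + DV x \<bullet> (D2V x *v e)"
        and ?e0 = "DV x \<bullet> (D2V x *v DV x)"
      have "(t *\<^sub>R e + (1/t) *\<^sub>R DV x) \<bullet> (((1/t) *\<^sub>R D2V x) *v (t *\<^sub>R e + (1/t) *\<^sub>R DV x))
          = t * ?e2 + (?e1 + ?e0 / t^2) / t"
        using t1 by (simp add: scaleR_matrix_vector_assoc[symmetric] matrix_vector_right_distrib
            matrix_vector_mult_scaleR inner_add_left inner_add_right field_simps power2_eq_square)
      also have "\<dots> \<le> q x * (t * ell e b x + 1 / t * V x)"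
      proof -
        have "\<bar>?e0 / t^2\<bar> \<le> \<bar>?e0\<bar>"
          using t1 mult_left_mono[of 1 "t^2" "\<bar>?e0\<bar>"] by (simp add: abs_divide divide_le_eq one_le_power)
        then have "?e1 + ?e0 / t^2 - q x * V x \<le> M"
          using M[OF x'] unfolding E_def by linarith
        then have "(?e1 + ?e0 / t^2 - q x * V x) / t \<le> M / t"
          using t1 by (intro divide_right_mono) auto
        also have "\<dots> \<le> M / 1"
          using t1 \<open>M > 0\<close> by (intro divide_left_mono) auto
        also have "\<dots> \<le> t * \<delta>"
          using t1(2) \<open>\<delta> > 0\<close> by (simp add: field_simps)
        also have "\<dots> \<le> t * (q x * ell e b x - ?e2)"
          using ee[OF x] t1 by (intro mult_left_mono) auto
        finally show ?thesis by (simp add: diff_divide_distrib add_divide_distrib algebra_simps)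
      qed
      finally show "(t *\<^sub>R e + (1/t) *\<^sub>R DV x) \<bullet> (((1/t) *\<^sub>R D2V x) *v (t *\<^sub>R e + (1/t) *\<^sub>R DV x))
          \<le> q x * (t * ell e b x + 1 / t * V x)" .
    qed
    then show "u y \<le> t * ell e b y + V y / t" by simp
  qed
qed

lemma C2_with_add:
  fixes f g :: "real ^ 'n \<Rightarrow> real"
  assumes "C2_with S f Df D2f" "C2_with S g Dg D2g"
  shows "C2_with S (\<lambda>x. f x + g x) (\<lambda>x. Df x + Dg x) (\<lambda>x. D2f x + D2g x)"
  unfolding C2_with_def
proof (intro conjI ballI)
  fix x assume x: "x \<in> S"
  show "GDERIV (\<lambda>x. f x + g x) x :> Df x + Dg x"
    using assms x unfolding C2_with_def by (blast intro: GDERIV_add)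
  have "((\<lambda>x. Df x + Dg x) has_derivative (\<lambda>h. D2f x *v h + D2g x *v h)) (at x)"
    using assms x unfolding C2_with_def by (intro has_derivative_add) blast+
  then show "((\<lambda>x. Df x + Dg x) has_derivative (*v) (D2f x + D2g x)) (at x)"
    by (simp only: matrix_vector_mult_add_rdistrib[symmetric])
next
  show "continuous_on S (\<lambda>x. D2f x + D2g x)"
    using assms by (intro continuous_intros C2_with_continuous(3))
qed

section \<open>Barriers around an axis\<close>

text \<open>
  The barrier of a chord \<open>{p + s e}\<close> is the sum of the two functions \<open>axial_profile\<close> and
  \<open>penalty\<close>. The first is the one-dimensional profile \<open>h\<close>, tilted by vectors \<open>a\<close> and \<open>c\<close>
  orthogonal to \<open>e\<close>. The tilt \<open>a + s c\<close> is affine in the axial coordinate \<open>s\<close>, so it can be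
  prescribed at both ends of the chord and does not change the second derivative in direction \<open>e\<close>.
\<close>

definition axial_profile ::
  "real ^ 'n \<Rightarrow> real ^ 'n \<Rightarrow> (real \<Rightarrow> real) \<Rightarrow> real ^ 'n \<Rightarrow> real ^ 'n \<Rightarrow> real ^ 'n \<Rightarrow> real" where
  "axial_profile p e h a c x =
     h (e \<bullet> (x - p)) + a \<bullet> (x - p) + (e \<bullet> (x - p)) * (c \<bullet> (x - p))"

text \<open>
  The square of the distance from \<open>x\<close> to the line through \<open>p\<close> in the direction of the unit vector \<open>e\<close>.
\<close>

definition axis_dist2 :: "real ^ 'n \<Rightarrow> real ^ 'n \<Rightarrow> real ^ 'n \<Rightarrow> real" where
  "axis_dist2 p e x = (x - p) \<bullet> (x - p) - (e \<bullet> (x - p))\<^sup>2"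

text \<open>
  This function vanishes to second order on the axis, so it affects neither the values nor the
  gradients there. Away from the axis \<open>A\<close> lowers the second derivative in direction \<open>e\<close>, and
  \<open>K\<close> raises the values.
\<close>

definition penalty :: "real ^ 'n \<Rightarrow> real ^ 'n \<Rightarrow> real \<Rightarrow> real \<Rightarrow> real ^ 'n \<Rightarrow> real" where
  "penalty p e A K x = (K - A * (e \<bullet> (x - p))\<^sup>2 / 2) * axis_dist2 p e x"

lemma axial_profile_C2:
  fixes p e a c :: "real ^ 'n"
  assumes h: "\<And>s. (h has_real_derivative h1 s) (at s)"
    and h1: "\<And>s. (h1 has_real_derivative h2 s) (at s)" and h2: "continuous_on UNIV h2"
    and "norm e = 1" "e \<bullet> c = 0"
  obtains D2 where
    "C2_with UNIV (axial_profile p e h a c)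
       (\<lambda>x. h1 (e \<bullet> (x - p)) *\<^sub>R e + a + (c \<bullet> (x - p)) *\<^sub>R e + (e \<bullet> (x - p)) *\<^sub>R c) D2"
    "\<And>x. e \<bullet> (D2 x *v e) = h2 (e \<bullet> (x - p))"
proof -
  define B where "B x k = (h2 (e \<bullet> (x - p)) * (e \<bullet> k)) *\<^sub>R e + (c \<bullet> k) *\<^sub>R e + (e \<bullet> k) *\<^sub>R c" for x k
  have s: "((\<lambda>x. e \<bullet> (x - p)) has_derivative (\<lambda>k. e \<bullet> k)) (at x)" for x
    by (auto intro!: derivative_eq_intros)
  have hs: "((\<lambda>x. h (e \<bullet> (x - p))) has_derivative (\<lambda>k. h1 (e \<bullet> (x - p)) * (e \<bullet> k))) (at x)"
    and h1s: "((\<lambda>x. h1 (e \<bullet> (x - p))) has_derivative (\<lambda>k. h2 (e \<bullet> (x - p)) * (e \<bullet> k))) (at x)" for x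
    using has_derivative_compose[OF s h[unfolded has_field_derivative_def]]
      has_derivative_compose[OF s h1[unfolded has_field_derivative_def]] by simp_all
  have D: "((\<lambda>x. h1 (e \<bullet> (x - p)) *\<^sub>R e + a + (c \<bullet> (x - p)) *\<^sub>R e + (e \<bullet> (x - p)) *\<^sub>R c)
      has_derivative B x) (at x)" for x
    unfolding B_def by (rule h1s derivative_eq_intros refl)+ (simp add: fun_eq_iff)
  have C2: "C2_with UNIV (axial_profile p e h a c)
       (\<lambda>x. h1 (e \<bullet> (x - p)) *\<^sub>R e + a + (c \<bullet> (x - p)) *\<^sub>R e + (e \<bullet> (x - p)) *\<^sub>R c) (\<lambda>x. matrix (B x))"
  proof (rule C2_withI[OF _ D])
    show "GDERIV (axial_profile p e h a c) x :>
       h1 (e \<bullet> (x - p)) *\<^sub>R e + a + (c \<bullet> (x - p)) *\<^sub>R e + (e \<bullet> (x - p)) *\<^sub>R c" for x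
      unfolding gderiv_def axial_profile_def
      by (rule hs derivative_eq_intros refl)+
         (simp add: fun_eq_iff inner_commute algebra_simps)
    have "continuous_on UNIV (\<lambda>x. h2 (e \<bullet> (x - p)))"
      by (rule continuous_on_compose2[OF h2]) (auto intro!: continuous_intros)
    then show "continuous_on UNIV (\<lambda>x. B x k)" for k
      unfolding B_def by (intro continuous_intros)
  qed
  have "e \<bullet> (matrix (B x) *v e) = h2 (e \<bullet> (x - p))" for x
    using matrix_vector_mul(2)[OF has_derivative_linear[OF D[of x]]] assms(4,5)
    by (simp add: B_def inner_add_right norm_eq_1 inner_commute fun_eq_iff)
  with C2 that show thesis by blast
qed

lemma penalty_C2:
  fixes p e :: "real ^ 'n"
  assumes "norm e = 1"
  obtains D2 where
    "C2_with UNIV (penalty p e A K)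
       (\<lambda>x. (K - A * (e \<bullet> (x - p))\<^sup>2 / 2) *\<^sub>R (2 *\<^sub>R ((x - p) - (e \<bullet> (x - p)) *\<^sub>R e))
            - (A * (e \<bullet> (x - p)) * axis_dist2 p e x) *\<^sub>R e) D2"
    "\<And>x. e \<bullet> (D2 x *v e) = - A * axis_dist2 p e x"
proof -
  define G where "G x = 2 *\<^sub>R ((x - p) - (e \<bullet> (x - p)) *\<^sub>R e)" for x
  define B where "B x k = (K - A * (e \<bullet> (x - p))\<^sup>2 / 2) *\<^sub>R (2 *\<^sub>R (k - (e \<bullet> k) *\<^sub>R e))
      - (A * (e \<bullet> (x - p)) * (e \<bullet> k)) *\<^sub>R G x
      - (A * (e \<bullet> (x - p)) * (G x \<bullet> k) + A * (e \<bullet> k) * axis_dist2 p e x) *\<^sub>R e" for x k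
  have N: "(axis_dist2 p e has_derivative (\<lambda>k. G x \<bullet> k)) (at x)" for x
    unfolding axis_dist2_def[abs_def] G_def
    by (rule derivative_eq_intros refl)+
       (simp add: fun_eq_iff inner_commute algebra_simps)
  have G: "(G has_derivative (\<lambda>k. 2 *\<^sub>R (k - (e \<bullet> k) *\<^sub>R e))) (at x)" for x
    unfolding G_def[abs_def] by (rule derivative_eq_intros refl)+ (simp add: fun_eq_iff)
  have m: "((\<lambda>x. K - A * (e \<bullet> (x - p))\<^sup>2 / 2) has_derivative
      (\<lambda>k. - (A * (e \<bullet> (x - p)) * (e \<bullet> k)))) (at x)" for x
    by (auto intro!: derivative_eq_intros simp: fun_eq_iff)
  have D: "((\<lambda>x. (K - A * (e \<bullet> (x - p))\<^sup>2 / 2) *\<^sub>R G x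
            - (A * (e \<bullet> (x - p)) * axis_dist2 p e x) *\<^sub>R e) has_derivative B x) (at x)" for x
    unfolding B_def by (rule m N G derivative_eq_intros refl)+ (simp add: fun_eq_iff algebra_simps)
  have C2: "C2_with UNIV (penalty p e A K)
       (\<lambda>x. (K - A * (e \<bullet> (x - p))\<^sup>2 / 2) *\<^sub>R G x
            - (A * (e \<bullet> (x - p)) * axis_dist2 p e x) *\<^sub>R e) (\<lambda>x. matrix (B x))"
  proof (rule C2_withI[OF _ D])
    show "GDERIV (penalty p e A K) x :> (K - A * (e \<bullet> (x - p))\<^sup>2 / 2) *\<^sub>R G x
            - (A * (e \<bullet> (x - p)) * axis_dist2 p e x) *\<^sub>R e" for x
      unfolding gderiv_def penalty_def[abs_def]
      by (rule m N derivative_eq_intros refl)+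
         (simp add: fun_eq_iff inner_commute algebra_simps)
    show "continuous_on UNIV (\<lambda>x. B x k)" for k
      unfolding B_def G_def axis_dist2_def by (intro continuous_intros) auto
  qed
  have "e \<bullet> (matrix (B x) *v e) = - A * axis_dist2 p e x" for x
    using matrix_vector_mul(2)[OF has_derivative_linear[OF D[of x]]] assms
    by (simp add: B_def G_def inner_add_right inner_diff_right inner_diff_left norm_eq_1 inner_commute fun_eq_iff)
  with C2 that show thesis unfolding G_def by blast
qed

lemma axis_dist2_nonneg:
  assumes "norm e = 1" shows "axis_dist2 p e x \<ge> 0"
  using Cauchy_Schwarz_ineq[of e "x - p"] assms by (simp add: axis_dist2_def norm_eq_1)

lemma axis_dist2_eq_norm:
  assumes "norm e = 1" shows "axis_dist2 p e x = (norm (x - p - (e \<bullet> (x - p)) *\<^sub>R e))\<^sup>2"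
  using assms unfolding axis_dist2_def power2_norm_eq_inner
  by (simp add: inner_diff_left inner_diff_right norm_eq_1 inner_commute power2_eq_square algebra_simps)

lemma axis_dist2_shift:
  assumes "norm e = 1" shows "axis_dist2 (p + s *\<^sub>R e) e x = axis_dist2 p e x"
proof -
  have "e \<bullet> (x - (p + s *\<^sub>R e)) = e \<bullet> (x - p) - s"
    using assms by (simp add: inner_diff_right inner_add_right norm_eq_1)
  then have "x - (p + s *\<^sub>R e) - (e \<bullet> (x - (p + s *\<^sub>R e))) *\<^sub>R e = x - p - (e \<bullet> (x - p)) *\<^sub>R e"
    by (simp add: algebra_simps)
  then show ?thesis by (simp only: axis_dist2_eq_norm[OF assms])
qed

lemma axis_dist2_eq_0_iff:
  assumes "norm e = 1" shows "axis_dist2 p e x = 0 \<longleftrightarrow> x = p + (e \<bullet> (x - p)) *\<^sub>R e"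
  by (auto simp: axis_dist2_eq_norm[OF assms] algebra_simps)

lemma continuous_on_axis_dist2: "continuous_on S (axis_dist2 p e)"
  unfolding axis_dist2_def[abs_def] by (intro continuous_intros)

section \<open>Local to global and second order estimates\<close>

text \<open>
  On a compact set a function is dominated by a multiple of \<open>N\<close> as soon as this holds near the zeros
  of \<open>N\<close>: near any other point \<open>N\<close> is bounded below by a positive constant. This is what allows the
  constants \<open>A\<close> and \<open>K\<close> of the barrier to be chosen globally although the profile only matches the
  equation on the chord and the boundary at its ends.
\<close>

lemma local_domination_imp_global:
  fixes f N :: "'a :: metric_space \<Rightarrow> real"
  assumes S: "compact S" and f: "continuous_on S f" and N: "continuous_on S N"
    and pos: "\<And>x. x \<in> S \<Longrightarrow> N x \<ge> 0"
    and loc: "\<And>y. y \<in> S \<Longrightarrow> N y = 0 \<Longrightarrow> \<exists>C d. d > 0 \<and> (\<forall>x\<in>S. dist x y < d \<longrightarrow> f x \<le> C * N x)"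
  shows "\<exists>C\<ge>0. \<forall>x\<in>S. f x \<le> C * N x"
proof -
  have "\<exists>C d. d > 0 \<and> (\<forall>x\<in>S. dist x y < d \<longrightarrow> f x \<le> C * N x)" if y: "y \<in> S" for y
  proof (cases "N y = 0")
    case False
    define C where "C = (\<bar>f y\<bar> + 1) / N y"
    have "N y > 0" using pos[OF y] False by simp
    have "continuous_on S (\<lambda>x. C * N x - f x)" by (intro continuous_intros f N)
    moreover have "C * N y - f y > 0" using \<open>N y > 0\<close> by (simp add: C_def)
    ultimately obtain d where "d > 0" "\<And>x. x \<in> S \<Longrightarrow> dist x y < d \<Longrightarrow>
        dist (C * N x - f x) (C * N y - f y) < C * N y - f y"
      using y unfolding continuous_on_iff by meson
    then show ?thesis by (intro exI[of _ C] exI[of _ d]) (force simp: dist_real_def)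
  qed (use loc y in blast)
  then have "\<forall>y\<in>S. \<exists>C d. d > 0 \<and> (\<forall>x\<in>S. dist x y < d \<longrightarrow> f x \<le> C * N x)" by blast
  then obtain C d where Cd: "\<And>y. y \<in> S \<Longrightarrow> d y > 0"
      "\<And>x y. y \<in> S \<Longrightarrow> x \<in> S \<Longrightarrow> dist x y < d y \<Longrightarrow> f x \<le> C y * N x"
    unfolding bchoice_iff by blast
  have "S \<subseteq> (\<Union>y\<in>S. ball y (d y))" using Cd(1) by force
  then obtain F where F: "F \<subseteq> S" "finite F" "S \<subseteq> (\<Union>y\<in>F. ball y (d y))"
    using compactE_image[OF S, of S "\<lambda>y. ball y (d y)"] by blast
  have "f x \<le> (\<Sum>y\<in>F. \<bar>C y\<bar>) * N x" if x: "x \<in> S" for x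
  proof -
    obtain y where y: "y \<in> F" "dist x y < d y"
      using F(3) x by (auto simp: dist_commute)
    then have "f x \<le> C y * N x" using Cd(2) F(1) x by blast
    also have "\<dots> \<le> (\<Sum>y\<in>F. \<bar>C y\<bar>) * N x"
      using member_le_sum[of y F "\<lambda>y. \<bar>C y\<bar>"] y F(2) pos[OF x] by (intro mult_right_mono) auto
    finally show ?thesis .
  qed
  then show ?thesis by (intro exI[of _ "\<Sum>y\<in>F. \<bar>C y\<bar>"]) (auto intro: sum_nonneg)
qed

text \<open>
  Differentiability of the gradient at \<open>y\<close> alone makes it Lipschitz with respect to the base
  point \<open>y\<close>; the mean value inequality on the segment from \<open>y\<close> to \<open>x\<close> turns this into a quadratic remainder.
\<close>

lemma second_order_remainder:
  fixes f :: "'a :: euclidean_space \<Rightarrow> real"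
  assumes "open U" "y \<in> U" and f: "\<And>x. x \<in> U \<Longrightarrow> GDERIV f x :> Df x"
    and Df: "(Df has_derivative D) (at y)"
  shows "\<exists>C\<ge>0. \<exists>d>0. ball y d \<subseteq> U \<and>
    (\<forall>x. dist x y < d \<longrightarrow> \<bar>f x - f y - Df y \<bullet> (x - y)\<bar> \<le> C * (norm (x - y))\<^sup>2)"
proof -
  obtain B where B: "\<And>h. norm (D h) \<le> norm h * B"
    using bounded_linear.bounded[OF has_derivative_bounded_linear[OF Df]] by blast
  obtain d1 where d1: "d1 > 0" "\<And>x. norm (x - y) < d1 \<Longrightarrow> norm (Df x - Df y - D (x - y)) \<le> 1 * norm (x - y)"
    using Df unfolding has_derivative_at_alt by (meson zero_less_one)
  obtain d2 where d2: "d2 > 0" "ball y d2 \<subseteq> U"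
    using assms(1,2) open_contains_ball by blast
  define d where "d = min d1 d2"
  have lip: "norm (Df x - Df y) \<le> (\<bar>B\<bar> + 1) * norm (x - y)" if "norm (x - y) < d" for x
  proof -
    have "norm (Df x - Df y) \<le> norm (Df x - Df y - D (x - y)) + norm (D (x - y))"
      using norm_triangle_ineq[of "Df x - Df y - D (x - y)" "D (x - y)"] by simp
    also have "\<dots> \<le> norm (x - y) + norm (x - y) * \<bar>B\<bar>"
      using d1(2)[of x] B[of "x - y"] that mult_left_mono[of B "\<bar>B\<bar>" "norm (x - y)"] by (force simp: d_def)
    finally show ?thesis by (simp add: algebra_simps)
  qed
  have "\<bar>f x - f y - Df y \<bullet> (x - y)\<bar> \<le> (\<bar>B\<bar> + 1) * (norm (x - y))\<^sup>2" if x: "dist x y < d" for x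
  proof -
    have seg: "closed_segment y x \<subseteq> cball y (dist x y)"
      using x by (intro closed_segment_subset) (auto simp: dist_commute)
    have "norm ((f x - Df y \<bullet> x) - (f y - Df y \<bullet> y)) \<le> ((\<bar>B\<bar> + 1) * dist x y) * norm (x - y)"
    proof (rule differentiable_bound[where S = "closed_segment y x" and f' = "\<lambda>z h. (Df z - Df y) \<bullet> h"])
      fix z assume "z \<in> closed_segment y x"
      then have z: "dist z y \<le> dist x y" using seg by (auto simp: dist_commute)
      then have "z \<in> U" using d2 x by (auto simp: d_def dist_commute)
      then have fz: "(f has_derivative (\<lambda>h. h \<bullet> Df z)) (at z within closed_segment y x)"
        using f[of z] by (auto simp: gderiv_def inner_commute intro: has_derivative_at_withinI)
      show "((\<lambda>z. f z - Df y \<bullet> z) has_derivative (\<lambda>h. (Df z - Df y) \<bullet> h)) (at z within closed_segment y x)"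
        by (rule fz derivative_eq_intros refl)+ (simp add: fun_eq_iff inner_diff_left inner_diff_right inner_commute)
      have "onorm (\<lambda>h. (Df z - Df y) \<bullet> h) \<le> norm (Df z - Df y)"
        by (intro onorm_le) (simp add: Cauchy_Schwarz_ineq2)
      also have "\<dots> \<le> (\<bar>B\<bar> + 1) * dist z y"
        using lip[of z] z x by (simp add: dist_norm)
      also have "\<dots> \<le> (\<bar>B\<bar> + 1) * dist x y"
        using z by (intro mult_left_mono) auto
      finally show "onorm (\<lambda>h. (Df z - Df y) \<bullet> h) \<le> (\<bar>B\<bar> + 1) * dist x y" .
    qed auto
    then show ?thesis by (simp add: inner_diff_right dist_norm power2_eq_square algebra_simps)
  qed
  moreover have "d > 0" "ball y d \<subseteq> U" using d1(1) d2 by (auto simp: d_def)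
  ultimately show ?thesis by (intro exI[of _ "\<bar>B\<bar> + 1"] conjI exI[of _ d]) auto
qed

section \<open>The outward normal of a convex domain with twice differentiable boundary\<close>

lemma DERIV_along_line:
  fixes f :: "'a :: real_inner \<Rightarrow> real"
  assumes "GDERIV f y :> g"
  shows "((\<lambda>r. f (y + r *\<^sub>R d)) has_real_derivative (g \<bullet> d)) (at 0)"
proof -
  have path: "((\<lambda>r. y + r *\<^sub>R d) has_derivative (\<lambda>r. r *\<^sub>R d)) (at 0)"
    by (auto intro!: derivative_eq_intros)
  have "(f has_derivative (\<lambda>h. h \<bullet> g)) (at (y + 0 *\<^sub>R d))"
    using assms by (simp add: gderiv_def inner_commute)
  from has_derivative_compose[OF path this] show ?thesis
    unfolding has_field_derivative_def by (simp add: inner_commute mult_commute_abs)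
qed

lemma open_contains_line_germ:
  fixes y :: "'a :: real_normed_vector"
  assumes "open U" "y \<in> U"
  obtains r0 where "r0 > 0" "\<And>r. \<bar>r\<bar> < r0 \<Longrightarrow> y + r *\<^sub>R d \<in> U"
proof -
  have "open ((\<lambda>r. y + r *\<^sub>R d) -` U)"
    using assms(1) by (intro open_vimage continuous_intros)
  moreover have "0 \<in> (\<lambda>r. y + r *\<^sub>R d) -` U" using assms(2) by simp
  ultimately obtain r0 where "r0 > 0" "ball 0 r0 \<subseteq> (\<lambda>r. y + r *\<^sub>R d) -` U"
    using open_contains_ball by blast
  then show thesis by (intro that[of r0]) (auto simp: subset_iff)
qed

lemma defining_function_zero_on_frontier:
  assumes op: "open \<Omega>" and ldf: "local_defining_function \<Omega> x U \<rho> D\<rho>" and y: "y \<in> frontier \<Omega>" "y \<in> U"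
  shows "\<rho> y = 0"
proof (rule antisym)
  have U: "open U" "\<Omega> \<inter> U = {y \<in> U. \<rho> y < 0}"
    using ldf by (auto simp: local_defining_function_def)
  have cont: "continuous_on U \<rho>"
    using ldf C2_with_continuous(1) unfolding local_defining_function_def by blast
  have "y \<notin> \<Omega>" using y op by (simp add: frontier_def interior_open)
  then show "0 \<le> \<rho> y" using U(2) y(2) by force
  show "\<rho> y \<le> 0"
  proof (rule ccontr)
    assume "\<not> \<rho> y \<le> 0"
    have op': "open (U \<inter> \<rho> -` {0<..})"
      by (rule continuous_open_preimage[OF cont U(1) open_greaterThan])
    have "y \<in> closure \<Omega> \<inter> (U \<inter> \<rho> -` {0<..})"
      using y \<open>\<not> \<rho> y \<le> 0\<close> by (auto simp: frontier_def)
    then have "(U \<inter> \<rho> -` {0<..}) \<inter> \<Omega> \<noteq> {}"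
      using open_Int_closure_eq_empty[OF op', of \<Omega>] by blast
    then obtain z where "z \<in> \<Omega> \<inter> U" "\<rho> z > 0" by auto
    then show False using U(2) by force
  qed
qed

text \<open>
  The defining function decreases from \<open>0\<close> along \<open>d\<close>, and it is negative exactly in \<open>\<Omega>\<close>.
\<close>

lemma descending_direction_enters:
  assumes op: "open \<Omega>" and ldf: "local_defining_function \<Omega> x U \<rho> D\<rho>" and y: "y \<in> frontier \<Omega>" "y \<in> U"
    and d: "D\<rho> y \<bullet> d < 0"
  shows "\<exists>r0>0. \<forall>r. 0 < r \<and> r < r0 \<longrightarrow> y + r *\<^sub>R d \<in> \<Omega>"
proof -
  have U: "open U" "\<Omega> \<inter> U = {y \<in> U. \<rho> y < 0}"
    and g: "GDERIV \<rho> y :> D\<rho> y"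
    using ldf y by (auto simp: local_defining_function_def C2_with_def)
  from DERIV_neg_dec_right[OF DERIV_along_line[OF g] d] obtain r1 where r1: "r1 > 0"
      "\<And>r. 0 < r \<Longrightarrow> r < r1 \<Longrightarrow> \<rho> (y + r *\<^sub>R d) < \<rho> y"
    by auto
  obtain r2 where r2: "r2 > 0" "\<And>r. \<bar>r\<bar> < r2 \<Longrightarrow> y + r *\<^sub>R d \<in> U"
    using open_contains_line_germ[OF U(1) y(2)] by blast
  have "y + r *\<^sub>R d \<in> \<Omega>" if "0 < r \<and> r < min r1 r2" for r
  proof -
    have "\<rho> (y + r *\<^sub>R d) < 0"
      using r1(2)[of r] that defining_function_zero_on_frontier[OF op ldf y] by simp
    then show ?thesis using U(2) r2(2)[of r] that by force
  qed
  then show ?thesis using r1(1) r2(1) by (intro exI[of _ "min r1 r2"]) auto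
qed

text \<open>
  A direction that enters \<open>\<Omega>\<close> according to one defining function cannot be ascending for another.
  So the open half space of descending directions of one gradient contains no ascending direction of
  the other, which forces the two gradients to be positively parallel.
\<close>

lemma defining_functions_same_normal:
  assumes op: "open \<Omega>" and x: "x \<in> frontier \<Omega>"
    and 1: "local_defining_function \<Omega> x U \<rho> D\<rho>" and 2: "local_defining_function \<Omega> x V \<sigma> D\<sigma>"
  shows "D\<rho> x /\<^sub>R norm (D\<rho> x) = D\<sigma> x /\<^sub>R norm (D\<sigma> x)"
proof -
  have xU: "x \<in> U" "x \<in> V" and nz: "D\<rho> x \<noteq> 0" "D\<sigma> x \<noteq> 0" and U: "open U" "\<Omega> \<inter> U = {y \<in> U. \<rho> y < 0}"
    and g: "GDERIV \<rho> x :> D\<rho> x"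
    using 1 2 by (auto simp: local_defining_function_def C2_with_def)
  have half: "\<not> D\<rho> x \<bullet> d > 0" if dneg: "D\<sigma> x \<bullet> d < 0" for d
  proof
    assume pos: "D\<rho> x \<bullet> d > 0"
    obtain r0 where r0: "r0 > 0" "\<And>r. 0 < r \<and> r < r0 \<Longrightarrow> x + r *\<^sub>R d \<in> \<Omega>"
      using descending_direction_enters[OF op 2 x xU(2) dneg] by blast
    have "D\<rho> x \<bullet> (- d) < 0" using pos by simp
    from DERIV_pos_inc_right[OF DERIV_along_line[OF g] pos] obtain r1 where r1: "r1 > 0"
        "\<And>r. 0 < r \<Longrightarrow> r < r1 \<Longrightarrow> \<rho> (x + r *\<^sub>R d) > \<rho> x"
      by auto
    obtain r2 where r2: "r2 > 0" "\<And>r. \<bar>r\<bar> < r2 \<Longrightarrow> x + r *\<^sub>R d \<in> U"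
      using open_contains_line_germ[OF U(1) xU(1)] by blast
    define r where "r = min r0 (min r1 r2) / 2"
    have r: "0 < r" "r < r0" "r < r1" "r < r2" using r0(1) r1(1) r2(1) by (auto simp: r_def)
    have "\<rho> (x + r *\<^sub>R d) < 0" using r0(2)[of r] r2(2)[of r] r U(2) by auto
    then show False
      using r1(2)[of r] r defining_function_zero_on_frontier[OF op 1 x xU(1)] by simp
  qed
  define n where "n = D\<rho> x /\<^sub>R norm (D\<rho> x)"
  define m where "m = D\<sigma> x /\<^sub>R norm (D\<sigma> x)"
  have nm: "n \<bullet> n = 1" "m \<bullet> m = 1"
    using nz by (auto simp: n_def m_def dot_square_norm power2_eq_square)
  have halfnm: "n \<bullet> d \<le> 0" if "m \<bullet> d < 0" for d
    using half[of d] that nz by (auto simp: n_def m_def field_simps mult_le_0_iff mult_less_0_iff)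
  have "n = m"
  proof (rule ccontr)
    assume "n \<noteq> m"
    have "0 < (n - m) \<bullet> (n - m)" using \<open>n \<noteq> m\<close> by simp
    then have "n \<bullet> m < 1" using nm by (simp add: inner_diff_left inner_diff_right inner_commute)
    moreover have "m \<bullet> (n - m) < 0" "n \<bullet> (n - m) > 0"
      using calculation nm by (simp_all add: inner_diff_right inner_commute)
    \<comment> \<open>For distinct unit vectors, \<open>n - m\<close> descends for \<open>m\<close> but ascends for \<open>n\<close>.\<close>
    ultimately show False using halfnm[of "n - m"] by simp
  qed
  then show ?thesis by (simp add: n_def m_def)
qed

lemma outward_unit_normal_eq:
  assumes "open \<Omega>" "x \<in> frontier \<Omega>" "local_defining_function \<Omega> x U \<rho> D\<rho>"
  shows "outward_unit_normal \<Omega> x = D\<rho> x /\<^sub>R norm (D\<rho> x)"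
  unfolding outward_unit_normal_def
proof (rule the_equality)
  fix \<nu> assume "\<exists>U \<rho> D\<rho>. local_defining_function \<Omega> x U \<rho> D\<rho> \<and> \<nu> = D\<rho> x /\<^sub>R norm (D\<rho> x)"
  then show "\<nu> = D\<rho> x /\<^sub>R norm (D\<rho> x)"
    using defining_functions_same_normal[OF assms(1,2)] assms(3) by blast
qed (use assms(3) in blast)

text \<open>
  The three properties of the normal that the barrier argument uses. Flatness holds since a defining
  function vanishes on the boundary, so that its first order part is bounded by its second
  order remainder.
\<close>

lemma C2_boundary_normal:
  assumes op: "open \<Omega>" and C2: "C2_boundary \<Omega>" and y: "y \<in> frontier \<Omega>"
  defines "\<nu> \<equiv> outward_unit_normal \<Omega> y"
  shows norm_outward_unit_normal: "norm \<nu> = 1"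
    and inward_direction_enters: "\<And>d. \<nu> \<bullet> d < 0 \<Longrightarrow> \<exists>r0>0. \<forall>r. 0 < r \<and> r < r0 \<longrightarrow> y + r *\<^sub>R d \<in> \<Omega>"
    and boundary_flat: "\<exists>C\<ge>0. \<exists>d>0. \<forall>x\<in>frontier \<Omega>. dist x y < d \<longrightarrow> \<bar>\<nu> \<bullet> (x - y)\<bar> \<le> C * (norm (x - y))\<^sup>2"
proof -
  obtain U \<rho> D\<rho> where ldf: "local_defining_function \<Omega> y U \<rho> D\<rho>"
    using C2 y by (auto simp: C2_boundary_def)
  have U: "open U" "y \<in> U" "D\<rho> y \<noteq> 0" and "\<exists>D2\<rho>. C2_with U \<rho> D\<rho> D2\<rho>"
    using ldf by (auto simp: local_defining_function_def)
  then obtain D2\<rho> where D: "\<And>x. x \<in> U \<Longrightarrow> GDERIV \<rho> x :> D\<rho> x"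
      "(D\<rho> has_derivative (\<lambda>h. D2\<rho> y *v h)) (at y)"
    by (auto simp: C2_with_def)
  have \<nu>: "\<nu> = D\<rho> y /\<^sub>R norm (D\<rho> y)"
    unfolding \<nu>_def by (rule outward_unit_normal_eq[OF op y ldf])
  show "norm \<nu> = 1" using U(3) by (simp add: \<nu>)
  show "\<exists>r0>0. \<forall>r. 0 < r \<and> r < r0 \<longrightarrow> y + r *\<^sub>R d \<in> \<Omega>" if "\<nu> \<bullet> d < 0" for d
  proof (rule descending_direction_enters[OF op ldf y U(2)])
    have "\<nu> \<bullet> d = D\<rho> y \<bullet> d / norm (D\<rho> y)" by (simp add: \<nu> divide_inverse mult.commute)
    then show "D\<rho> y \<bullet> d < 0" using that U(3) by (simp add: divide_less_0_iff)
  qed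
  have "\<exists>C\<ge>0. \<exists>d>0. ball y d \<subseteq> U \<and>
      (\<forall>x. dist x y < d \<longrightarrow> \<bar>\<rho> x - \<rho> y - D\<rho> y \<bullet> (x - y)\<bar> \<le> C * (norm (x - y))\<^sup>2)"
    by (rule second_order_remainder[OF U(1,2) _ D(2)]) (rule D(1))
  then obtain C d where Cd: "d > 0" "ball y d \<subseteq> U" "C \<ge> 0"
      "\<forall>x. dist x y < d \<longrightarrow> \<bar>\<rho> x - \<rho> y - D\<rho> y \<bullet> (x - y)\<bar> \<le> C * (norm (x - y))\<^sup>2"
    by (elim exE conjE)
  have "\<bar>\<nu> \<bullet> (x - y)\<bar> \<le> (C / norm (D\<rho> y)) * (norm (x - y))\<^sup>2" if x: "x \<in> frontier \<Omega>" "dist x y < d" for x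
  proof -
    have "\<rho> x = 0" "\<rho> y = 0"
      using defining_function_zero_on_frontier[OF op ldf] y U(2) x Cd(2) by (auto simp: dist_commute subset_iff)
    then have "\<bar>D\<rho> y \<bullet> (x - y)\<bar> / norm (D\<rho> y) \<le> C * (norm (x - y))\<^sup>2 / norm (D\<rho> y)"
      using Cd(4)[rule_format, OF x(2)] by (intro divide_right_mono) auto
    then show ?thesis by (simp add: \<nu> divide_inverse abs_mult mult_ac)
  qed
  then show "\<exists>C\<ge>0. \<exists>d>0. \<forall>x\<in>frontier \<Omega>. dist x y < d \<longrightarrow> \<bar>\<nu> \<bullet> (x - y)\<bar> \<le> C * (norm (x - y))\<^sup>2"
    using Cd(1,3) by (intro exI[of _ "C / norm (D\<rho> y)"] conjI exI[of _ d]) auto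
qed

text \<open>
  If a point of the convex set \<open>\<Omega>\<close> lay strictly beyond the tangent plane at \<open>y\<close>, then \<open>y\<close> would lie
  between it and a point of \<open>\<Omega>\<close> reached by entering in the opposite direction. Openness upgrades
  the resulting weak inequality to a strict one.
\<close>

lemma normal_transversal:
  assumes op: "open \<Omega>" and C2: "C2_boundary \<Omega>" and y: "y \<in> frontier \<Omega>"
    and "convex \<Omega>" and w: "w \<in> \<Omega>"
  shows "outward_unit_normal \<Omega> y \<bullet> (w - y) < 0"
proof -
  define \<nu> where "\<nu> = outward_unit_normal \<Omega> y"
  note N = C2_boundary_normal[OF op C2 y, folded \<nu>_def]
  have le: "\<nu> \<bullet> (z - y) \<le> 0" if z: "z \<in> \<Omega>" for z
  proof (rule ccontr)
    assume "\<not> \<nu> \<bullet> (z - y) \<le> 0"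
    then have "\<nu> \<bullet> (y - z) < 0" by (simp add: inner_diff_right)
    then obtain r0 where r0: "r0 > 0" "\<And>r. 0 < r \<and> r < r0 \<Longrightarrow> y + r *\<^sub>R (y - z) \<in> \<Omega>"
      using N(2) by blast
    have in\<Omega>: "y + (r0/2) *\<^sub>R (y - z) \<in> \<Omega>" using r0 by simp
    define u where "u = 1 / (1 + r0/2)"
    have u: "0 < u" "u < 1" using r0(1) by (auto simp: u_def)
    have "(1 - u) *\<^sub>R z + u *\<^sub>R (y + (r0/2) *\<^sub>R (y - z)) \<in> \<Omega>"
      using convexD_alt[OF \<open>convex \<Omega>\<close> z in\<Omega>, of u] u by simp
    moreover have "(1 - u) *\<^sub>R z + u *\<^sub>R (y + (r0/2) *\<^sub>R (y - z)) = (u * (1 + r0/2)) *\<^sub>R y + (1 - u * (1 + r0/2)) *\<^sub>R z"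
      by (simp add: algebra_simps)
    moreover have "u * (1 + r0/2) = 1" using r0(1) by (simp add: u_def)
    ultimately have "y \<in> \<Omega>" by simp
    then show False using y op by (simp add: frontier_def interior_open)
  qed
  obtain r where r: "r > 0" "cball w r \<subseteq> \<Omega>"
    using op w open_contains_cball by blast
  have "w + r *\<^sub>R \<nu> \<in> \<Omega>" using r N(1) by (auto simp: subset_iff dist_norm)
  from le[OF this] have "\<nu> \<bullet> (w - y) + r * (\<nu> \<bullet> \<nu>) \<le> 0"
    by (simp add: inner_diff_right inner_add_right)
  then show ?thesis using r(1) N(1) unfolding \<nu>_def[symmetric] by (simp add: norm_eq_1)
qed

text \<open>
  Along the boundary, a displacement is tangential up to second order. If the axis is not tangential,
  the axial part of the displacement is therefore controlled by its part orthogonal to the axis.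
\<close>

lemma boundary_near_transversal_axis:
  assumes op: "open \<Omega>" and C2: "C2_boundary \<Omega>" and y: "y \<in> frontier \<Omega>"
    and e: "norm e = 1" and tr: "outward_unit_normal \<Omega> y \<bullet> e \<noteq> 0"
  shows "\<exists>C\<ge>0. \<exists>d>0. \<forall>x\<in>frontier \<Omega>. dist x y < d \<longrightarrow> (norm (x - y))\<^sup>2 \<le> C * axis_dist2 y e x"
proof -
  define \<nu> where "\<nu> = outward_unit_normal \<Omega> y"
  note N = C2_boundary_normal[OF op C2 y, folded \<nu>_def]
  define k where "k = \<bar>\<nu> \<bullet> e\<bar>"
  have k: "k > 0" using tr by (simp add: k_def \<nu>_def)
  obtain C d where C: "C \<ge> 0" "d > 0" and
      flat: "\<forall>x\<in>frontier \<Omega>. dist x y < d \<longrightarrow> \<bar>\<nu> \<bullet> (x - y)\<bar> \<le> C * (norm (x - y))\<^sup>2"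
    using N(3) by (elim exE conjE)
  \<comment> \<open>Closer than this to \<open>y\<close>, the quadratic term is at most \<open>k / 2\<close> times the displacement and can be absorbed.\<close>
  define d' where "d' = min d (k / (2 * (C + 1)))"
  have "(norm (x - y))\<^sup>2 \<le> (2 * (1 + 1/k))\<^sup>2 * axis_dist2 y e x" if x: "x \<in> frontier \<Omega>" "dist x y < d'" for x
  proof -
    define s where "s = e \<bullet> (x - y)"
    define z where "z = x - y - s *\<^sub>R e"
    have xy: "x - y = s *\<^sub>R e + z" by (simp add: z_def)
    have "k * \<bar>s\<bar> = \<bar>\<nu> \<bullet> (x - y) - \<nu> \<bullet> z\<bar>" by (simp add: xy inner_add_right k_def abs_mult)
    also have "\<dots> \<le> \<bar>\<nu> \<bullet> (x - y)\<bar> + \<bar>\<nu> \<bullet> z\<bar>" by simp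
    also have "\<dots> \<le> C * (norm (x - y))\<^sup>2 + norm z"
      using bspec[OF flat x(1)] x(2) Cauchy_Schwarz_ineq2[of \<nu> z] N(1) by (intro add_mono) (auto simp: d'_def)
    also have "C * (norm (x - y))\<^sup>2 \<le> (C + 1) * (norm (x - y) * (k / (2 * (C + 1))))"
      unfolding power2_eq_square using x(2) C(1) by (intro mult_mono mult_left_mono) (auto simp: d'_def dist_norm)
    also have "\<dots> = k * (norm (x - y) / 2)"
      using C(1) by (simp add: field_simps)
    finally have "k * \<bar>s\<bar> \<le> k * (norm (x - y) / 2) + norm z" by simp
    then have "\<bar>s\<bar> \<le> norm (x - y) / 2 + norm z / k"
      using k by (simp add: field_simps)
    moreover have "norm (x - y) \<le> \<bar>s\<bar> + norm z"
      using norm_triangle_ineq[of "s *\<^sub>R e" z] e by (simp add: xy)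
    ultimately have "norm (x - y) \<le> 2 * norm z + 2 * (norm z / k)" by linarith
    then have "norm (x - y) \<le> 2 * (1 + 1/k) * norm z"
      by (simp add: algebra_simps)
    then have "(norm (x - y))\<^sup>2 \<le> (2 * (1 + 1/k) * norm z)\<^sup>2" by (intro power_mono) auto
    then show ?thesis by (simp add: power_mult_distrib axis_dist2_eq_norm[OF e] z_def s_def)
  qed
  moreover have "d' > 0" using C(1,2) k by (simp add: d'_def)
  ultimately show ?thesis by (intro exI[of _ "(2 * (1 + 1/k))\<^sup>2"] conjI exI[of _ d']) auto
qed

section \<open>Chords and their barriers\<close>

definition is_chord :: "(real ^ 'n) set \<Rightarrow> real ^ 'n \<Rightarrow> real ^ 'n \<Rightarrow> real \<Rightarrow> bool" where
  "is_chord \<Omega> p e L \<longleftrightarrow> norm e = 1 \<and> L > 0 \<and> p \<in> frontier \<Omega> \<and> p + L *\<^sub>R e \<in> frontier \<Omega> \<and>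
     (\<forall>s. 0 < s \<and> s < L \<longrightarrow> p + s *\<^sub>R e \<in> \<Omega>)"

lemma chord_through:
  fixes x e :: "real ^ 'n"
  assumes "open \<Omega>" "bounded \<Omega>" "x \<in> \<Omega>" "norm e = 1"
  obtains p L s where "is_chord \<Omega> p e L" "0 < s" "s < L" "x = p + s *\<^sub>R e"
proof -
  have x: "x \<in> interior \<Omega>" and e: "e \<noteq> 0" "- e \<noteq> 0" using assms by (auto simp: interior_open)
  obtain r where r: "0 < r" "x + r *\<^sub>R e \<in> frontier \<Omega>"
      "\<And>s. 0 \<le> s \<Longrightarrow> s < r \<Longrightarrow> x + s *\<^sub>R e \<in> interior \<Omega>"
    using ray_to_frontier[OF assms(2) x e(1)] by blast
  obtain l where l: "0 < l" "x + l *\<^sub>R (- e) \<in> frontier \<Omega>"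
      "\<And>s. 0 \<le> s \<Longrightarrow> s < l \<Longrightarrow> x + s *\<^sub>R (- e) \<in> interior \<Omega>"
    using ray_to_frontier[OF assms(2) x e(2)] by blast
  have "x - l *\<^sub>R e + s *\<^sub>R e \<in> \<Omega>" if s: "0 < s" "s < l + r" for s
  proof (cases "s \<le> l")
    case True
    have "x + (l - s) *\<^sub>R (- e) \<in> interior \<Omega>" using True s by (intro l(3)) auto
    also have "x + (l - s) *\<^sub>R (- e) = x - l *\<^sub>R e + s *\<^sub>R e" by (simp add: algebra_simps)
    finally show ?thesis using interior_subset by blast
  next
    case False
    have "x + (s - l) *\<^sub>R e \<in> interior \<Omega>" using False s by (intro r(3)) auto
    also have "x + (s - l) *\<^sub>R e = x - l *\<^sub>R e + s *\<^sub>R e" by (simp add: algebra_simps)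
    finally show ?thesis using interior_subset by blast
  qed
  moreover have "x - l *\<^sub>R e + (l + r) *\<^sub>R e \<in> frontier \<Omega>"
  proof -
    have "x - l *\<^sub>R e + (l + r) *\<^sub>R e = x + r *\<^sub>R e" by (simp add: algebra_simps)
    with r(2) show ?thesis by (simp only:)
  qed
  ultimately have "is_chord \<Omega> (x - l *\<^sub>R e) e (l + r)"
    using r(1,2) l(1,2) assms(4) by (auto simp: is_chord_def)
  from that[OF this, of l] l(1) r(1) show thesis by simp
qed

lemma chord_subset_closure:
  assumes "is_chord \<Omega> p e L" "0 \<le> s" "s \<le> L"
  shows "p + s *\<^sub>R e \<in> closure \<Omega>"
proof -
  consider "s = 0" | "s = L" | "0 < s" "s < L" using assms(2,3) by linarith
  then show ?thesis
    using assms(1) closure_subset[of \<Omega>] by cases (auto simp: is_chord_def frontier_def)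
qed

text \<open>
  A point of the closure beyond an end of the chord would put that end on an open segment which starts
  in the interior of \<open>\<Omega>\<close>, hence inside \<open>\<Omega>\<close>.
\<close>

lemma chord_closure:
  assumes "open \<Omega>" "convex \<Omega>" and ch: "is_chord \<Omega> p e L" and s: "p + s *\<^sub>R e \<in> closure \<Omega>"
  shows "0 \<le> s" "s \<le> L"
proof -
  have L: "L > 0" and e: "e \<noteq> 0" and mid: "p + (L/2) *\<^sub>R e \<in> interior \<Omega>"
    and ends: "p + 0 *\<^sub>R e \<notin> interior \<Omega>" "p + L *\<^sub>R e \<notin> interior \<Omega>"
    using ch assms(1) by (auto simp: is_chord_def interior_open frontier_def)
  have "p + r *\<^sub>R e \<in> interior \<Omega>" if "0 < u" "u < 1" "r = L/2 + u * (s - L/2)" "r \<noteq> L/2" for r u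
  proof -
    have "p + r *\<^sub>R e = (1 - u) *\<^sub>R (p + (L/2) *\<^sub>R e) + u *\<^sub>R (p + s *\<^sub>R e)"
    proof -
      have "(1 - u) *\<^sub>R (p + c *\<^sub>R e) + u *\<^sub>R (p + s *\<^sub>R e) = p + (c + u * (s - c)) *\<^sub>R e" for c
        by (simp add: algebra_simps)
      then show ?thesis by (simp only: that(3))
    qed
    moreover have "s \<noteq> L/2"
    proof
      assume "s = L/2"
      then have "r = L/2" using that(3) by simp
      with that(4) show False by simp
    qed
    then have "p + (L/2) *\<^sub>R e \<noteq> p + s *\<^sub>R e" using e by simp
    ultimately have "p + r *\<^sub>R e \<in> open_segment (p + (L/2) *\<^sub>R e) (p + s *\<^sub>R e)"
      using that(1,2) unfolding in_segment by blast
    then show ?thesis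
      using in_interior_closure_convex_segment[OF assms(2) mid s] by blast
  qed note * = this
  show "0 \<le> s"
  proof (rule ccontr)
    assume "\<not> 0 \<le> s"
    then show False
      using *[of "(L/2) / (L/2 - s)" 0] ends(1) L by (simp add: field_simps)
  qed
  show "s \<le> L"
  proof (rule ccontr)
    assume "\<not> s \<le> L"
    then show False
      using *[of "(L/2) / (s - L/2)" L] ends(2) L by (simp add: field_simps)
  qed
qed

lemma chord_ends:
  assumes "open \<Omega>" "convex \<Omega>" "is_chord \<Omega> p e L" "p + s *\<^sub>R e \<in> frontier \<Omega>"
  shows "s = 0 \<or> s = L"
proof -
  have s: "p + s *\<^sub>R e \<in> closure \<Omega>" "p + s *\<^sub>R e \<notin> \<Omega>"
    using assms(1,4) by (auto simp: frontier_def interior_open)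
  have "\<not> (0 < s \<and> s < L)" using s(2) assms(3) unfolding is_chord_def by blast
  with chord_closure[OF assms(1-3) s(1)] show ?thesis by linarith
qed

lemma chord_end_transversal:
  assumes op: "open \<Omega>" and cvx: "convex \<Omega>" and C2: "C2_boundary \<Omega>" and ch: "is_chord \<Omega> p e L"
  shows "outward_unit_normal \<Omega> p \<bullet> e < 0" "outward_unit_normal \<Omega> (p + L *\<^sub>R e) \<bullet> e > 0"
proof -
  have L: "L > 0" and mid: "p + (L/2) *\<^sub>R e \<in> \<Omega>"
    and ends: "p \<in> frontier \<Omega>" "p + L *\<^sub>R e \<in> frontier \<Omega>"
    using ch by (auto simp: is_chord_def)
  show "outward_unit_normal \<Omega> p \<bullet> e < 0"
    using normal_transversal[OF op C2 ends(1) cvx mid] L by (simp add: mult_less_0_iff)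
  have half: "p + (L/2) *\<^sub>R e - (p + L *\<^sub>R e) = (L/2 - L) *\<^sub>R e"
    by (simp only: add_diff_cancel_left scaleR_left_diff_distrib)
  then show "outward_unit_normal \<Omega> (p + L *\<^sub>R e) \<bullet> e > 0"
    using normal_transversal[OF op C2 ends(2) cvx mid] L unfolding half
    by (simp add: mult_less_0_iff zero_less_mult_iff)
qed

text \<open>
  The tilt of the profile is chosen so that the gradient of the barrier at the end with coordinate
  \<open>s\<close> is \<open>h' s / (\<nu> \<bullet> e)\<close> times the normal \<open>\<nu>\<close>. Hence, near the ends of the chord, the tilted profile is
  at most quadratic in the distance to the axis along the boundary, and the penalty term can make the barrier nonnegative.
\<close>

lemma chord_barrier:
  fixes \<Omega> :: "(real ^ 'n) set"
  assumes op: "open \<Omega>" and bounded: "bounded \<Omega>" and cvx: "convex \<Omega>" and C2: "C2_boundary \<Omega>"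
    and ch: "is_chord \<Omega> p e L"
    and q: "continuous_on (closure \<Omega>) q"
    and h: "\<And>s. (h has_real_derivative h1 s) (at s)"
    and h1: "\<And>s. (h1 has_real_derivative h2 s) (at s)" and h2: "continuous_on UNIV h2"
    and h0: "h 0 = 0" and hL: "h L = 0"
    and strict: "\<And>s. 0 \<le> s \<Longrightarrow> s \<le> L \<Longrightarrow> h2 s < q (p + s *\<^sub>R e) * ell e b (p + s *\<^sub>R e)"
  obtains V DV D2V \<delta> where "C2_with UNIV V DV D2V" "\<delta> > 0"
    "\<And>x. x \<in> \<Omega> \<Longrightarrow> e \<bullet> (D2V x *v e) \<le> q x * ell e b x - \<delta>"
    "\<And>x. x \<in> frontier \<Omega> \<Longrightarrow> V x \<ge> 0"
    "\<And>s. s \<in> {0, L} \<Longrightarrow> V (p + s *\<^sub>R e) = 0"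
    "\<And>s \<nu>. s \<in> {0, L} \<Longrightarrow> \<nu> = outward_unit_normal \<Omega> (p + s *\<^sub>R e) \<Longrightarrow>
        DV (p + s *\<^sub>R e) \<bullet> \<nu> = h1 s / (\<nu> \<bullet> e)"
proof -
  have e: "norm e = 1" "e \<bullet> e = 1" and L: "L > 0"
    and ends: "\<And>s. s \<in> {0, L} \<Longrightarrow> p + s *\<^sub>R e \<in> frontier \<Omega>"
    using ch by (auto simp: is_chord_def norm_eq_1)
  note chord = chord_subset_closure[OF ch]
  define n where "n s = outward_unit_normal \<Omega> (p + s *\<^sub>R e)" for s
  have n: "n s \<bullet> e \<noteq> 0" "n s \<bullet> n s = 1" if "s \<in> {0, L}" for s
    using chord_end_transversal[OF op cvx C2 ch] that norm_outward_unit_normal[OF op C2 ends[OF that]]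
    by (auto simp: n_def norm_eq_1)
  \<comment> \<open>\<open>a s\<close> is the vector orthogonal to \<open>e\<close> that turns \<open>h1 s *\<^sub>R e\<close> into a multiple of the normal.\<close>
  define a where "a s = (h1 s / (n s \<bullet> e)) *\<^sub>R n s - h1 s *\<^sub>R e" for s
  define c where "c = (1 / L) *\<^sub>R (a L - a 0)"
  have ae: "e \<bullet> a 0 = 0" "e \<bullet> a L = 0"
    using n(1)[of 0] n(1)[of L] e(2) by (simp_all add: a_def inner_diff_right inner_commute)
  have ce: "e \<bullet> c = 0" by (simp add: c_def inner_diff_right ae)
  have a_at: "a 0 + s *\<^sub>R c = a s" if "s \<in> {0, L}" for s
    using that L by (auto simp: c_def)
  let ?k = "axial_profile p e h (a 0) c" and ?N = "axis_dist2 p e"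
  obtain D2k where k: "C2_with UNIV ?k
       (\<lambda>x. h1 (e \<bullet> (x - p)) *\<^sub>R e + a 0 + (c \<bullet> (x - p)) *\<^sub>R e + (e \<bullet> (x - p)) *\<^sub>R c) D2k"
      "\<And>x. e \<bullet> (D2k x *v e) = h2 (e \<bullet> (x - p))"
    using axial_profile_C2[OF h h1 h2 e(1) ce] by blast
  define Dk where "Dk x = h1 (e \<bullet> (x - p)) *\<^sub>R e + a 0 + (c \<bullet> (x - p)) *\<^sub>R e + (e \<bullet> (x - p)) *\<^sub>R c" for x
  have k_end: "?k (p + s *\<^sub>R e) = 0" "Dk (p + s *\<^sub>R e) = (h1 s / (n s \<bullet> e)) *\<^sub>R n s" if s: "s \<in> {0, L}" for s
  proof -
    have "c \<bullet> e = 0" "a 0 \<bullet> e = 0" using ce ae by (simp_all add: inner_commute)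
    then show "?k (p + s *\<^sub>R e) = 0"
      using s h0 hL e by (auto simp: axial_profile_def)
    have Dk_s: "Dk (p + s *\<^sub>R e) = h1 s *\<^sub>R e + (a 0 + s *\<^sub>R c)"
      using \<open>c \<bullet> e = 0\<close> e by (simp add: Dk_def)
    show "Dk (p + s *\<^sub>R e) = (h1 s / (n s \<bullet> e)) *\<^sub>R n s"
      unfolding Dk_s a_at[OF s] by (simp add: a_def)
  qed
  \<comment> \<open>The gap has a positive minimum on the compact chord. Half of it is kept as \<open>\<delta>\<close>, and off the
      chord the deficit is made up by a multiple \<open>A\<close> of the squared distance to the axis.\<close>
  have "continuous_on {0..L} (\<lambda>s. q (p + s *\<^sub>R e) * ell e b (p + s *\<^sub>R e) - h2 s)"
    unfolding ell_def
    by (intro continuous_intros continuous_on_compose2[OF q] continuous_on_subset[OF h2]) (use chord in auto)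
  then obtain s0 where s0: "s0 \<in> {0..L}" "\<And>s. s \<in> {0..L} \<Longrightarrow>
      q (p + s0 *\<^sub>R e) * ell e b (p + s0 *\<^sub>R e) - h2 s0 \<le> q (p + s *\<^sub>R e) * ell e b (p + s *\<^sub>R e) - h2 s"
    using continuous_attains_inf[of "{0..L}" "\<lambda>s. q (p + s *\<^sub>R e) * ell e b (p + s *\<^sub>R e) - h2 s"] L by auto
  define \<delta> where "\<delta> = (q (p + s0 *\<^sub>R e) * ell e b (p + s0 *\<^sub>R e) - h2 s0) / 2"
  have \<delta>: "\<delta> > 0" using strict[of s0] s0(1) by (simp add: \<delta>_def)
  have "\<exists>A\<ge>0. \<forall>x\<in>closure \<Omega>. h2 (e \<bullet> (x - p)) - q x * ell e b x + \<delta> \<le> A * ?N x"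
  proof (rule local_domination_imp_global)
    show "compact (closure \<Omega>)" using bounded by simp
    show cont: "continuous_on (closure \<Omega>) (\<lambda>x. h2 (e \<bullet> (x - p)) - q x * ell e b x + \<delta>)"
      unfolding ell_def by (intro continuous_intros q continuous_on_compose2[OF h2]) auto
    show "continuous_on (closure \<Omega>) ?N" by (rule continuous_on_axis_dist2)
    show "?N x \<ge> 0" for x by (rule axis_dist2_nonneg[OF e(1)])
    fix y assume y: "y \<in> closure \<Omega>" "?N y = 0"
    define s where "s = e \<bullet> (y - p)"
    have ys: "y = p + s *\<^sub>R e" using y(2) axis_dist2_eq_0_iff[OF e(1)] by (simp add: s_def)
    have "s \<in> {0..L}" using chord_closure[OF op cvx ch] y(1) ys by auto
    then have "h2 (e \<bullet> (y - p)) - q y * ell e b y + \<delta> < 0"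
      using s0(2)[of s] \<delta> unfolding s_def[symmetric] by (simp add: \<delta>_def ys field_simps)
    then obtain d where "d > 0" and d: "\<And>x. x \<in> closure \<Omega> \<Longrightarrow> dist x y < d \<Longrightarrow>
        dist (h2 (e \<bullet> (x - p)) - q x * ell e b x + \<delta>) (h2 (e \<bullet> (y - p)) - q y * ell e b y + \<delta>)
          < - (h2 (e \<bullet> (y - p)) - q y * ell e b y + \<delta>)"
      using cont y(1) unfolding continuous_on_iff by (meson neg_0_less_iff_less)
    have "h2 (e \<bullet> (x - p)) - q x * ell e b x + \<delta> \<le> 0 * ?N x" if "x \<in> closure \<Omega>" "dist x y < d" for x
      using d[OF that] by (simp add: dist_real_def)
    with \<open>d > 0\<close> show "\<exists>C d. 0 < d \<and> (\<forall>x\<in>closure \<Omega>. dist x y < d \<longrightarrow>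
        h2 (e \<bullet> (x - p)) - q x * ell e b x + \<delta> \<le> C * ?N x)"
      by blast
  qed
  then obtain A where A: "A \<ge> 0"
      "\<And>x. x \<in> closure \<Omega> \<Longrightarrow> h2 (e \<bullet> (x - p)) - q x * ell e b x + \<delta> \<le> A * ?N x"
    by blast
  \<comment> \<open>On the boundary the axis is met only at the two ends of the chord, so a quadratic bound for the
      tilted profile there extends to the whole boundary.\<close>
  have "\<exists>C\<ge>0. \<forall>x\<in>frontier \<Omega>. - ?k x \<le> C * ?N x"
  proof (rule local_domination_imp_global)
    show "compact (frontier \<Omega>)" using bounded by (rule compact_frontier_bounded)
    show "continuous_on (frontier \<Omega>) (\<lambda>x. - ?k x)"
      by (intro continuous_intros continuous_on_subset[OF C2_with_continuous(1)[OF k(1)]]) auto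
    show "continuous_on (frontier \<Omega>) ?N" by (rule continuous_on_axis_dist2)
    show "?N x \<ge> 0" for x by (rule axis_dist2_nonneg[OF e(1)])
    fix y assume y: "y \<in> frontier \<Omega>" "?N y = 0"
    define s where "s = e \<bullet> (y - p)"
    have ys: "y = p + s *\<^sub>R e" using y(2) axis_dist2_eq_0_iff[OF e(1)] by (simp add: s_def)
    have s: "s \<in> {0, L}" using chord_ends[OF op cvx ch] y(1) ys by auto
    define \<kappa> where "\<kappa> = h1 s / (n s \<bullet> e)"
    have ky: "?k y = 0" "Dk y = \<kappa> *\<^sub>R n s" using k_end[OF s] by (simp_all add: ys \<kappa>_def)
    have "\<exists>C\<ge>0. \<exists>d>0. ball y d \<subseteq> UNIV \<and>
        (\<forall>x. dist x y < d \<longrightarrow> \<bar>?k x - ?k y - Dk y \<bullet> (x - y)\<bar> \<le> C * (norm (x - y))\<^sup>2)"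
      by (rule second_order_remainder[where D = "\<lambda>h. D2k y *v h"])
         (use k(1) in \<open>auto simp: C2_with_def Dk_def\<close>)
    then obtain C1 d1 where C1: "C1 \<ge> 0" "d1 > 0"
        "\<forall>x. dist x y < d1 \<longrightarrow> \<bar>?k x - ?k y - Dk y \<bullet> (x - y)\<bar> \<le> C1 * (norm (x - y))\<^sup>2"
      by (elim exE conjE)
    obtain C2 d2 where C2': "C2 \<ge> 0" "d2 > 0"
        "\<forall>x\<in>frontier \<Omega>. dist x y < d2 \<longrightarrow> \<bar>n s \<bullet> (x - y)\<bar> \<le> C2 * (norm (x - y))\<^sup>2"
      using boundary_flat[OF op C2 y(1)] unfolding n_def ys by (elim exE conjE)
    have tr: "outward_unit_normal \<Omega> y \<bullet> e \<noteq> 0" using n(1)[OF s] by (simp add: n_def ys)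
    obtain C3 d3 where C3: "C3 \<ge> 0" "d3 > 0"
        "\<forall>x\<in>frontier \<Omega>. dist x y < d3 \<longrightarrow> (norm (x - y))\<^sup>2 \<le> C3 * axis_dist2 y e x"
      using boundary_near_transversal_axis[OF op C2 y(1) e(1) tr] by (elim exE conjE)
    have "- ?k x \<le> ((C1 + \<bar>\<kappa>\<bar> * C2) * C3) * ?N x"
      if x: "x \<in> frontier \<Omega>" "dist x y < min d1 (min d2 d3)" for x
    proof -
      have "\<bar>?k x - Dk y \<bullet> (x - y)\<bar> \<le> C1 * (norm (x - y))\<^sup>2" using C1(3) x(2) ky(1) by simp
      moreover have "\<bar>Dk y \<bullet> (x - y)\<bar> \<le> \<bar>\<kappa>\<bar> * (C2 * (norm (x - y))\<^sup>2)"
        using C2'(3) x by (simp add: ky(2) abs_mult mult_left_mono)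
      ultimately have "- ?k x \<le> (C1 + \<bar>\<kappa>\<bar> * C2) * (norm (x - y))\<^sup>2"
        by (simp add: algebra_simps)
      also have "\<dots> \<le> (C1 + \<bar>\<kappa>\<bar> * C2) * (C3 * ?N x)"
        using C3(3) x C1(1) C2'(1) by (intro mult_left_mono) (auto simp: ys axis_dist2_shift[OF e(1)])
      finally show ?thesis by (simp add: mult.assoc)
    qed
    then show "\<exists>C d. 0 < d \<and> (\<forall>x\<in>frontier \<Omega>. dist x y < d \<longrightarrow> - ?k x \<le> C * ?N x)"
      using C1(2) C2'(2) C3(2) by (intro exI[of _ "(C1 + \<bar>\<kappa>\<bar> * C2) * C3"] exI[of _ "min d1 (min d2 d3)"]) auto
  qed
  then obtain C where C: "C \<ge> 0" "\<And>x. x \<in> frontier \<Omega> \<Longrightarrow> - ?k x \<le> C * ?N x"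
    by blast
  have "bounded (frontier \<Omega>)" by (rule compact_imp_bounded[OF compact_frontier_bounded[OF bounded]])
  then obtain B where B: "\<And>x. x \<in> frontier \<Omega> \<Longrightarrow> norm x \<le> B"
    by (auto simp: bounded_iff)
  define R where "R = B + norm p"
  have R: "norm (x - p) \<le> R" if "x \<in> frontier \<Omega>" for x
    using B[OF that] norm_triangle_ineq4[of x p] by (simp add: R_def)
  \<comment> \<open>The second summand compensates the term with \<open>A\<close>, whose sign is unfavourable here.\<close>
  define K where "K = C + A * R\<^sup>2 / 2"
  obtain D2w where w: "C2_with UNIV (penalty p e A K)
       (\<lambda>x. (K - A * (e \<bullet> (x - p))\<^sup>2 / 2) *\<^sub>R (2 *\<^sub>R ((x - p) - (e \<bullet> (x - p)) *\<^sub>R e))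
            - (A * (e \<bullet> (x - p)) * axis_dist2 p e x) *\<^sub>R e) D2w"
    "\<And>x. e \<bullet> (D2w x *v e) = - A * axis_dist2 p e x"
    using penalty_C2[OF e(1)] by blast
  show thesis
  proof (rule that[OF C2_with_add[OF k(1) w(1)] \<delta>])
    fix x assume "x \<in> \<Omega>"
    then show "e \<bullet> ((D2k x + D2w x) *v e) \<le> q x * ell e b x - \<delta>"
      using A(2)[of x] closure_subset[of \<Omega>]
      by (auto simp: matrix_vector_mult_add_rdistrib inner_add_right k(2) w(2))
  next
    fix x assume x: "x \<in> frontier \<Omega>"
    have "\<bar>e \<bullet> (x - p)\<bar> \<le> R"
      using Cauchy_Schwarz_ineq2[of e "x - p"] R[OF x] e(1) by simp
    then have "(e \<bullet> (x - p))\<^sup>2 \<le> R\<^sup>2" using abs_le_square_iff[of "e \<bullet> (x - p)" R] by simp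
    then have "A * (e \<bullet> (x - p))\<^sup>2 \<le> A * R\<^sup>2" using A(1) by (rule mult_left_mono)
    then have "C * ?N x \<le> (K - A * (e \<bullet> (x - p))\<^sup>2 / 2) * ?N x"
      using axis_dist2_nonneg[OF e(1)] by (intro mult_right_mono) (auto simp: K_def)
    then show "0 \<le> ?k x + penalty p e A K x"
      using C(2)[OF x] by (simp add: penalty_def)
  next
    fix s assume s: "s \<in> {0, L}"
    have N0: "?N (p + s *\<^sub>R e) = 0" using axis_dist2_eq_0_iff[OF e(1)] e(2) by simp
    then show "?k (p + s *\<^sub>R e) + penalty p e A K (p + s *\<^sub>R e) = 0"
      using k_end(1)[OF s] by (simp add: penalty_def)
    fix \<nu> assume "\<nu> = outward_unit_normal \<Omega> (p + s *\<^sub>R e)"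
    then have \<nu>: "\<nu> = n s" by (simp add: n_def)
    have "Dk (p + s *\<^sub>R e) + ((K - A * (e \<bullet> (p + s *\<^sub>R e - p))\<^sup>2 / 2) *\<^sub>R (2 *\<^sub>R ((p + s *\<^sub>R e - p) - (e \<bullet> (p + s *\<^sub>R e - p)) *\<^sub>R e))
            - (A * (e \<bullet> (p + s *\<^sub>R e - p)) * ?N (p + s *\<^sub>R e)) *\<^sub>R e) = (h1 s / (n s \<bullet> e)) *\<^sub>R n s"
      using e(2) by (simp add: N0 k_end(2)[OF s])
    then show "(h1 (e \<bullet> (p + s *\<^sub>R e - p)) *\<^sub>R e + a 0 + (c \<bullet> (p + s *\<^sub>R e - p)) *\<^sub>R e + (e \<bullet> (p + s *\<^sub>R e - p)) *\<^sub>R c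
        + ((K - A * (e \<bullet> (p + s *\<^sub>R e - p))\<^sup>2 / 2) *\<^sub>R (2 *\<^sub>R ((p + s *\<^sub>R e - p) - (e \<bullet> (p + s *\<^sub>R e - p)) *\<^sub>R e))
            - (A * (e \<bullet> (p + s *\<^sub>R e - p)) * ?N (p + s *\<^sub>R e)) *\<^sub>R e)) \<bullet> \<nu> = h1 s / (\<nu> \<bullet> e)"
      unfolding Dk_def[symmetric] by (simp add: \<nu> n(2)[OF s])
  qed
qed

section \<open>Neumann data at the ends of a chord\<close>

text \<open>
  The solution lies below \<open>t \<ell> + V / t\<close> and agrees with it at the ends of the chord. Moving inwards
  along the normal from such an end orders the two normal derivatives.
\<close>

lemma DN_lower_bound_at_chord_ends:
  fixes \<Omega> :: "(real ^ 'n) set"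
  assumes op: "open \<Omega>" and bounded: "bounded \<Omega>" and cvx: "convex \<Omega>" and C2: "C2_boundary \<Omega>"
    and ch: "is_chord \<Omega> p e L"
    and q: "continuous_on (closure \<Omega>) q" "\<And>x. x \<in> \<Omega> \<Longrightarrow> q x > 0"
    and h: "\<And>s. (h has_real_derivative h1 s) (at s)"
    and h1: "\<And>s. (h1 has_real_derivative h2 s) (at s)" and h2: "continuous_on UNIV h2"
    and h0: "h 0 = 0" and hL: "h L = 0"
    and strict: "\<And>s. 0 \<le> s \<Longrightarrow> s \<le> L \<Longrightarrow> h2 s < q (p + s *\<^sub>R e) * ell e b (p + s *\<^sub>R e)"
  shows "\<exists>T>0. \<forall>t\<ge>T. \<forall>g. has_DN_data \<Omega> q (\<lambda>x. t * ell e b x) g \<longrightarrow>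
    (\<forall>s\<in>{0, L}. \<forall>\<nu>. \<nu> = outward_unit_normal \<Omega> (p + s *\<^sub>R e) \<longrightarrow>
      g (p + s *\<^sub>R e) \<ge> t * (\<nu> \<bullet> e) + h1 s / (\<nu> \<bullet> e) / t)"
proof -
  obtain V DV D2V \<delta> where V: "C2_with UNIV V DV D2V" "\<delta> > 0"
    "\<And>x. x \<in> \<Omega> \<Longrightarrow> e \<bullet> (D2V x *v e) \<le> q x * ell e b x - \<delta>"
    "\<And>x. x \<in> frontier \<Omega> \<Longrightarrow> V x \<ge> 0"
    and V_end: "\<And>s. s \<in> {0, L} \<Longrightarrow> V (p + s *\<^sub>R e) = 0"
    "\<And>s \<nu>. s \<in> {0, L} \<Longrightarrow> \<nu> = outward_unit_normal \<Omega> (p + s *\<^sub>R e) \<Longrightarrow>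
        DV (p + s *\<^sub>R e) \<bullet> \<nu> = h1 s / (\<nu> \<bullet> e)"
    using chord_barrier[OF op bounded cvx C2 ch q(1) h h1 h2 h0 hL strict] by metis
  obtain T where T: "T > 0" and le: "\<And>t u x. t \<ge> T \<Longrightarrow> dirichlet_solution \<Omega> q (\<lambda>x. t * ell e b x) u \<Longrightarrow>
      x \<in> closure \<Omega> \<Longrightarrow> u x \<le> t * ell e b x + V x / t"
    using solution_le_first_order_barrier[OF op bounded q V] by blast
  have "g (p + s *\<^sub>R e) \<ge> t * (\<nu> \<bullet> e) + h1 s / (\<nu> \<bullet> e) / t"
    if t: "t \<ge> T" and g: "has_DN_data \<Omega> q (\<lambda>x. t * ell e b x) g" and s: "s \<in> {0, L}"
      and \<nu>: "\<nu> = outward_unit_normal \<Omega> (p + s *\<^sub>R e)" for t g s \<nu>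
  proof -
    define y where "y = p + s *\<^sub>R e"
    have y: "y \<in> frontier \<Omega>" using ch s by (auto simp: is_chord_def y_def)
    obtain u Du where u: "dirichlet_solution \<Omega> q (\<lambda>x. t * ell e b x) u"
        "(u has_derivative (\<lambda>h. Du y \<bullet> h)) (at y within closure \<Omega>)" "g y = Du y \<bullet> \<nu>"
      using g y unfolding has_DN_data_def \<nu> y_def by blast
    have nu1: "\<nu> \<bullet> \<nu> = 1"
      using norm_outward_unit_normal[OF op C2 y] by (simp add: \<nu> y_def norm_eq_1)
    then have "outward_unit_normal \<Omega> y \<bullet> (- \<nu>) < 0" by (simp add: \<nu> y_def)
    from inward_direction_enters[OF op C2 y this] obtain r0 where
      r0: "r0 > 0" "\<forall>r. 0 < r \<and> r < r0 \<longrightarrow> y + r *\<^sub>R (- \<nu>) \<in> \<Omega>" by blast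
    define \<psi> where "\<psi> x = t * ell e b x + (1/t) * V x" for x
    define F where "F r = \<psi> (y + r *\<^sub>R (- \<nu>)) - u (y + r *\<^sub>R (- \<nu>))" for r
    have path: "y + r *\<^sub>R (- \<nu>) \<in> closure \<Omega>" if "r \<in> {0..<r0}" for r
      using r0(2) that y closure_subset[of \<Omega>] by (cases "r = 0") (auto simp: frontier_def)
    have "GDERIV \<psi> y :> t *\<^sub>R e + (1/t) *\<^sub>R DV y"
      using C2_affine_plus_scaled[OF V(1), of t e b "1/t"] by (simp add: C2_with_def \<psi>_def[abs_def])
    from DERIV_along_line[OF this, of "- \<nu>"]
    have 1: "((\<lambda>r. \<psi> (y + r *\<^sub>R (- \<nu>))) has_real_derivative ((t *\<^sub>R e + (1/t) *\<^sub>R DV y) \<bullet> (- \<nu>))) (at 0 within {0..<r0})"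
      by (rule has_field_derivative_at_within)
    have line: "((\<lambda>r. y + r *\<^sub>R (- \<nu>)) has_derivative (\<lambda>r. r *\<^sub>R (- \<nu>))) (at 0 within {0..<r0})"
      by (auto intro!: derivative_eq_intros)
    have du: "(u has_derivative (\<lambda>h. Du y \<bullet> h)) (at (y + 0 *\<^sub>R (- \<nu>)) within (\<lambda>r. y + r *\<^sub>R (- \<nu>)) ` {0..<r0})"
      using has_derivative_subset[OF u(2)] path by (simp add: image_subset_iff)
    have 2: "((\<lambda>r. u (y + r *\<^sub>R (- \<nu>))) has_real_derivative (Du y \<bullet> (- \<nu>))) (at 0 within {0..<r0})"
    proof -
      have "(\<lambda>r. Du y \<bullet> (r *\<^sub>R (- \<nu>))) = (*) (Du y \<bullet> (- \<nu>))" by (simp add: fun_eq_iff)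
      with has_derivative_in_compose[OF line du] show ?thesis
        unfolding has_field_derivative_def by (simp only:)
    qed
    have F: "(F has_real_derivative ((t *\<^sub>R e + (1/t) *\<^sub>R DV y) \<bullet> (- \<nu>) - Du y \<bullet> (- \<nu>))) (at 0 within {0..<r0})"
      unfolding F_def[abs_def] by (rule DERIV_diff[OF 1 2])
    have "(t *\<^sub>R e + (1/t) *\<^sub>R DV y) \<bullet> (- \<nu>) - Du y \<bullet> (- \<nu>) \<ge> 0"
    proof (rule ccontr)
      assume "\<not> ?thesis"
      then obtain d where d: "d > 0" "\<forall>h>0. 0 + h \<in> {0..<r0} \<longrightarrow> h < d \<longrightarrow> F 0 > F (0 + h)"
        using has_real_derivative_neg_dec_right[OF F] by auto
      define h where "h = min d r0 / 2"
      have h: "0 < h" "h < d" "h < r0" using d(1) r0(1) by (auto simp: h_def)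
      have "F 0 = 0"
        using u(1) y V_end(1)[OF s] by (simp add: F_def \<psi>_def dirichlet_solution_def flip: y_def)
      moreover have "F h \<ge> 0"
        using le[OF t u(1) path[of h]] h by (simp add: F_def \<psi>_def)
      ultimately show False using d(2) h by force
    qed
    then show ?thesis
      using V_end(2)[OF s \<nu>] u(3) by (simp add: y_def[symmetric] inner_add_right inner_commute)
  qed
  with T show ?thesis by blast
qed

lemma C2_with_uminus:
  fixes f :: "real ^ 'n \<Rightarrow> real"
  assumes "C2_with S f Df D2f"
  shows "C2_with S (\<lambda>x. - f x) (\<lambda>x. - Df x) (\<lambda>x. - D2f x)"
  using C2_affine_plus_scaled[OF assms, of 0 0 0 "-1"] by simp

lemma F_op_uminus:
  fixes v :: "real ^ 'n"
  shows "F_op q x (- r) v X = - F_op q x r (- v) (- X)"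
proof -
  have "(- X) *v (- v) = X *v v"
    using scaleR_matrix_vector_assoc[of "-1" X "- v"] linear_neg[OF matrix_vector_mul_linear, of X v] by simp
  then show ?thesis by (simp add: F_op_def)
qed

lemma subsolution_uminus:
  fixes u :: "real ^ 'n \<Rightarrow> real"
  assumes "viscosity_supersolution \<Omega> q u"
  shows "viscosity_subsolution \<Omega> q (\<lambda>x. - u x)"
  unfolding viscosity_subsolution_def
proof (intro conjI allI ballI impI)
  show "continuous_on \<Omega> (\<lambda>x. - u x)"
    using assms by (auto simp: viscosity_supersolution_def intro: continuous_intros)
  fix \<phi> D\<phi> D2\<phi> x assume x: "x \<in> \<Omega>" and \<phi>: "C2_with \<Omega> \<phi> D\<phi> D2\<phi>"
    and "\<forall>\<^sub>F y in at x within \<Omega>. - u y - \<phi> y \<le> - u x - \<phi> x"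
  then have "\<forall>\<^sub>F y in at x within \<Omega>. u y - (- \<phi> y) \<ge> u x - (- \<phi> x)"
    by (elim eventually_mono) simp
  with assms x C2_with_uminus[OF \<phi>] have "F_op q x (u x) (- D\<phi> x) (- D2\<phi> x) \<ge> 0"
    unfolding viscosity_supersolution_def by blast
  then show "F_op q x (- u x) (D\<phi> x) (D2\<phi> x) \<le> 0"
    by (simp add: F_op_uminus[of q x "u x"])
qed

lemma supersolution_uminus:
  fixes u :: "real ^ 'n \<Rightarrow> real"
  assumes "viscosity_subsolution \<Omega> q u"
  shows "viscosity_supersolution \<Omega> q (\<lambda>x. - u x)"
  unfolding viscosity_supersolution_def
proof (intro conjI allI ballI impI)
  show "continuous_on \<Omega> (\<lambda>x. - u x)"
    using assms by (auto simp: viscosity_subsolution_def intro: continuous_intros)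
  fix \<phi> D\<phi> D2\<phi> x assume x: "x \<in> \<Omega>" and \<phi>: "C2_with \<Omega> \<phi> D\<phi> D2\<phi>"
    and "\<forall>\<^sub>F y in at x within \<Omega>. - u y - \<phi> y \<ge> - u x - \<phi> x"
  then have "\<forall>\<^sub>F y in at x within \<Omega>. u y - (- \<phi> y) \<le> u x - (- \<phi> x)"
    by (elim eventually_mono) simp
  with assms x C2_with_uminus[OF \<phi>] have "F_op q x (u x) (- D\<phi> x) (- D2\<phi> x) \<le> 0"
    unfolding viscosity_subsolution_def by blast
  then show "F_op q x (- u x) (D\<phi> x) (D2\<phi> x) \<ge> 0"
    by (simp add: F_op_uminus[of q x "u x"])
qed

lemma has_DN_data_uminus:
  fixes f g :: "real ^ 'n \<Rightarrow> real"
  assumes "has_DN_data \<Omega> q f g"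
  shows "has_DN_data \<Omega> q (\<lambda>x. - f x) (\<lambda>x. - g x)"
proof -
  obtain u Du where u: "dirichlet_solution \<Omega> q f u"
    "\<forall>x\<in>frontier \<Omega>. (u has_derivative (\<lambda>h. Du x \<bullet> h)) (at x within closure \<Omega>) \<and>
           g x = Du x \<bullet> outward_unit_normal \<Omega> x"
    using assms unfolding has_DN_data_def by blast
  have "dirichlet_solution \<Omega> q (\<lambda>x. - f x) (\<lambda>x. - u x)"
    using u(1) by (auto simp: dirichlet_solution_def viscosity_solution_def
        intro: continuous_intros subsolution_uminus supersolution_uminus)
  moreover have der: "((\<lambda>x. - u x) has_derivative (\<lambda>h. - Du x \<bullet> h)) (at x within closure \<Omega>)" if "x \<in> frontier \<Omega>" for x
  proof -
    have "(\<lambda>h. - (Du x \<bullet> h)) = (\<lambda>h. - Du x \<bullet> h)" by (simp add: fun_eq_iff)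
    with has_derivative_minus[OF conjunct1[OF bspec[OF u(2) that]]] show ?thesis by (simp only:)
  qed
  ultimately show ?thesis
    unfolding has_DN_data_def
    by (intro exI[of _ "\<lambda>x. - u x"] exI[of _ "\<lambda>x. - Du x"] conjI ballI der) (use u(2) in auto)
qed

lemma chord_reverse:
  assumes "is_chord \<Omega> p e L"
  shows "is_chord \<Omega> (p + L *\<^sub>R e) (- e) L"
  unfolding is_chord_def
proof (intro conjI allI impI)
  fix s assume "0 < s \<and> s < L"
  then have "p + (L - s) *\<^sub>R e \<in> \<Omega>" using assms by (simp add: is_chord_def)
  then show "p + L *\<^sub>R e + s *\<^sub>R (- e) \<in> \<Omega>" by (simp add: algebra_simps)
qed (use assms in \<open>auto simp: is_chord_def\<close>)

text \<open>
  The equation is odd in \<open>u\<close>, so the lower bound applies to \<open>- u\<close>, whose boundary values belong to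
  \<open>- e\<close> and \<open>- b\<close>. This reverses the direction of the chord, so the profile to use is
  \<open>- h (L - s)\<close>.
\<close>

lemma DN_upper_bound_at_chord_ends:
  fixes \<Omega> :: "(real ^ 'n) set"
  assumes op: "open \<Omega>" and bounded: "bounded \<Omega>" and cvx: "convex \<Omega>" and C2: "C2_boundary \<Omega>"
    and ch: "is_chord \<Omega> p e L"
    and q: "continuous_on (closure \<Omega>) q" "\<And>x. x \<in> \<Omega> \<Longrightarrow> q x > 0"
    and h: "\<And>s. (h has_real_derivative h1 s) (at s)"
    and h1: "\<And>s. (h1 has_real_derivative h2 s) (at s)" and h2: "continuous_on UNIV h2"
    and h0: "h 0 = 0" and hL: "h L = 0"
    and strict: "\<And>s. 0 \<le> s \<Longrightarrow> s \<le> L \<Longrightarrow> h2 s > q (p + s *\<^sub>R e) * ell e b (p + s *\<^sub>R e)"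
  shows "\<exists>T>0. \<forall>t\<ge>T. \<forall>g. has_DN_data \<Omega> q (\<lambda>x. t * ell e b x) g \<longrightarrow>
    (\<forall>s\<in>{0, L}. \<forall>\<nu>. \<nu> = outward_unit_normal \<Omega> (p + s *\<^sub>R e) \<longrightarrow>
      g (p + s *\<^sub>R e) \<le> t * (\<nu> \<bullet> e) + h1 s / (\<nu> \<bullet> e) / t)"
proof -
  define P where "P = p + L *\<^sub>R e"
  have Ps: "P + s *\<^sub>R (- e) = p + (L - s) *\<^sub>R e" for s by (simp add: P_def algebra_simps)
  have neg: "ell (- e) (- b) x = - ell e b x" for x by (simp add: ell_def)
  have d: "((\<lambda>s. - h (L - s)) has_real_derivative h1 (L - s)) (at s)"
    "((\<lambda>s. h1 (L - s)) has_real_derivative - h2 (L - s)) (at s)" for s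
    using DERIV_minus[OF DERIV_chain2[OF h DERIV_diff[OF DERIV_const DERIV_ident]]]
      DERIV_chain2[OF h1 DERIV_diff[OF DERIV_const DERIV_ident]] by simp_all
  have c: "continuous_on UNIV (\<lambda>s. - h2 (L - s))"
    by (intro continuous_intros continuous_on_compose2[OF h2]) auto
  have "- h2 (L - s) < q (P + s *\<^sub>R (- e)) * ell (- e) (- b) (P + s *\<^sub>R (- e))"
    if "0 \<le> s" "s \<le> L" for s
    unfolding Ps neg using strict[of "L - s"] that by simp
  from DN_lower_bound_at_chord_ends[OF op bounded cvx C2 chord_reverse[OF ch, folded P_def] q d c _ _ this]
  obtain T where T: "T > 0" and "\<forall>t\<ge>T. \<forall>g. has_DN_data \<Omega> q (\<lambda>x. t * ell (- e) (- b) x) g \<longrightarrow>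
    (\<forall>s\<in>{0, L}. \<forall>\<nu>. \<nu> = outward_unit_normal \<Omega> (P + s *\<^sub>R (- e)) \<longrightarrow>
      g (P + s *\<^sub>R (- e)) \<ge> t * (\<nu> \<bullet> (- e)) + h1 (L - s) / (\<nu> \<bullet> (- e)) / t)"
    using h0 hL by auto
  note lower = this(2)[rule_format]
  show ?thesis
  proof (intro exI[of _ T] conjI T allI impI ballI)
    fix t g s \<nu> assume t: "t \<ge> T" and g: "has_DN_data \<Omega> q (\<lambda>x. t * ell e b x) g"
      and s: "s \<in> {0, L}" and \<nu>: "\<nu> = outward_unit_normal \<Omega> (p + s *\<^sub>R e)"
    have "has_DN_data \<Omega> q (\<lambda>x. t * ell (- e) (- b) x) (\<lambda>x. - g x)"
      using has_DN_data_uminus[OF g] by (simp add: neg)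
    moreover have "P + (L - s) *\<^sub>R (- e) = p + s *\<^sub>R e" by (simp only: Ps diff_diff_eq2 add_diff_cancel_left')
    ultimately show "g (p + s *\<^sub>R e) \<le> t * (\<nu> \<bullet> e) + h1 s / (\<nu> \<bullet> e) / t"
      using lower[OF t, of "\<lambda>x. - g x" "L - s" \<nu>] s \<nu> by auto
  qed
qed

lemma dirichlet_profile_exists:
  fixes G :: "real \<Rightarrow> real"
  assumes G: "continuous_on {0..L} G" and L: "L > 0"
  shows "\<exists>h h1 h2. (\<forall>s. (h has_real_derivative h1 s) (at s)) \<and>
    (\<forall>s. (h1 has_real_derivative h2 s) (at s)) \<and> continuous_on UNIV h2 \<and> h 0 = 0 \<and> h L = 0 \<and>
    (\<forall>s\<in>{0..L}. h2 s = G s) \<and> h1 L - h1 0 = integral {0..L} G"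
proof -
  \<comment> \<open>\<open>G\<close> is extended by its end values, since the profile has to be twice differentiable on the whole line.\<close>
  define h2 where "h2 s = G (max 0 (min L s))" for s
  have h2_G: "h2 s = G s" if "0 \<le> s" "s \<le> L" for s
    using that by (simp add: h2_def min_def)
  have c: "continuous_on UNIV h2"
    unfolding h2_def by (rule continuous_on_compose2[OF G]) (use L in \<open>auto intro!: continuous_intros\<close>)
  have antideriv: "\<exists>F. \<forall>x. (F has_real_derivative f x) (at x)" if "continuous_on UNIV f" for f :: "real \<Rightarrow> real"
    using einterval_antiderivative[of "-\<infinity>" "\<infinity>" f] that
    by (auto simp: continuous_on_eq_continuous_at has_real_derivative_iff_has_vector_derivative)
  obtain H1 where H1: "\<And>x. (H1 has_real_derivative h2 x) (at x)" using antideriv[OF c] by blast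
  have "continuous_on UNIV H1"
    using H1 by (meson DERIV_isCont continuous_at_imp_continuous_on)
  then obtain H where H: "\<And>x. (H has_real_derivative H1 x) (at x)" using antideriv by blast
  define m where "m = (H L - H 0) / L"
  have "((\<lambda>s. H s - H 0 - s * m) has_real_derivative H1 s - m) (at s)" for s
    using H by (auto intro!: derivative_eq_intros)
  moreover have "((\<lambda>s. H1 s - m) has_real_derivative h2 s) (at s)" for s
    using H1 by (auto intro!: derivative_eq_intros)
  moreover have "(h2 has_integral (H1 L - H1 0)) {0..L}"
    using L H1 by (intro fundamental_theorem_of_calculus)
      (auto simp: has_real_derivative_iff_has_vector_derivative[symmetric] intro: has_field_derivative_at_within)
  then have "(G has_integral (H1 L - H1 0)) {0..L}"
    by (rule has_integral_eq[rotated]) (auto simp: h2_G)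
  ultimately show ?thesis
    using L by (intro exI[of _ "\<lambda>s. H s - H 0 - s * m"] exI[of _ "\<lambda>s. H1 s - m"] exI[of _ h2])
      (use c h2_G in \<open>auto simp: m_def integral_unique\<close>)
qed

text \<open>
  Profiles with second derivative slightly below \<open>q \<ell>\<close> and slightly above \<open>q' \<ell>\<close> bound the common
  Neumann data from below and from above. At the starting point of the chord \<open>\<nu> \<bullet> e < 0\<close> and at the
  other end \<open>\<nu> \<bullet> e > 0\<close>, so the slopes of the profiles are ordered in opposite ways at the two
  ends; their difference is the integral of the second derivative.
\<close>

lemma chord_integral_le:
  fixes \<Omega> :: "(real ^ 'n) set"
  assumes op: "open \<Omega>" and bounded: "bounded \<Omega>" and cvx: "convex \<Omega>" and C2: "C2_boundary \<Omega>"
    and ch: "is_chord \<Omega> p e L"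
    and q: "continuous_on (closure \<Omega>) q" "\<And>x. x \<in> \<Omega> \<Longrightarrow> q x > 0"
    and q': "continuous_on (closure \<Omega>) q'" "\<And>x. x \<in> \<Omega> \<Longrightarrow> q' x > 0"
    and DN: "\<And>t. t \<ge> t0 \<Longrightarrow> \<exists>g. has_DN_data \<Omega> q (\<lambda>x. t * ell e b x) g \<and> has_DN_data \<Omega> q' (\<lambda>x. t * ell e b x) g"
  shows "integral {0..L} (\<lambda>s. q (p + s *\<^sub>R e) * ell e b (p + s *\<^sub>R e))
       \<le> integral {0..L} (\<lambda>s. q' (p + s *\<^sub>R e) * ell e b (p + s *\<^sub>R e))"
    (is "integral _ ?G \<le> integral _ ?G'")
proof -
  have L: "L > 0" using ch by (simp add: is_chord_def)
  have clos: "p + s *\<^sub>R e \<in> closure \<Omega>" if "s \<in> {0..L}" for s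
    using chord_subset_closure[OF ch] that by simp
  have G: "continuous_on {0..L} ?G" "continuous_on {0..L} ?G'"
    unfolding ell_def
    by (intro continuous_intros continuous_on_compose2[OF q(1)] continuous_on_compose2[OF q'(1)]; use clos in auto)+
  have "integral {0..L} ?G \<le> integral {0..L} ?G' + \<epsilon>" if "\<epsilon> > 0" for \<epsilon>
  proof -
    \<comment> \<open>Lowering one integrand and raising the other by \<open>\<delta>\<close> changes the comparison by \<open>2 \<delta> L\<close>.\<close>
    define \<delta> where "\<delta> = \<epsilon> / (2 * L)"
    have \<delta>: "\<delta> > 0" using that L by (simp add: \<delta>_def)
    have "continuous_on {0..L} (\<lambda>s. ?G s - \<delta>)" by (intro continuous_intros G)
    from dirichlet_profile_exists[OF this L]
    obtain h h1 h2 where h': "\<forall>s. (h has_real_derivative h1 s) (at s)"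
      "\<forall>s. (h1 has_real_derivative h2 s) (at s)" "continuous_on UNIV h2" "h 0 = 0" "h L = 0"
      and h2: "\<forall>s\<in>{0..L}. h2 s = ?G s - \<delta>"
      and hI: "h1 L - h1 0 = integral {0..L} (\<lambda>s. ?G s - \<delta>)"
      by (elim exE conjE)
    note h = spec[OF h'(1)] spec[OF h'(2)] h'(3-5)
    have "continuous_on {0..L} (\<lambda>s. ?G' s + \<delta>)" by (intro continuous_intros G)
    from dirichlet_profile_exists[OF this L]
    obtain k k1 k2 where k': "\<forall>s. (k has_real_derivative k1 s) (at s)"
      "\<forall>s. (k1 has_real_derivative k2 s) (at s)" "continuous_on UNIV k2" "k 0 = 0" "k L = 0"
      and k2: "\<forall>s\<in>{0..L}. k2 s = ?G' s + \<delta>"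
      and kI: "k1 L - k1 0 = integral {0..L} (\<lambda>s. ?G' s + \<delta>)"
      by (elim exE conjE)
    note k = spec[OF k'(1)] spec[OF k'(2)] k'(3-5)
    have "h2 s < ?G s" if "0 \<le> s" "s \<le> L" for s using h2 that \<delta> by simp
    from DN_lower_bound_at_chord_ends[OF op bounded cvx C2 ch q h this]
    obtain T where T: "T > 0" "\<forall>t\<ge>T. \<forall>g. has_DN_data \<Omega> q (\<lambda>x. t * ell e b x) g \<longrightarrow>
      (\<forall>s\<in>{0, L}. \<forall>\<nu>. \<nu> = outward_unit_normal \<Omega> (p + s *\<^sub>R e) \<longrightarrow>
        g (p + s *\<^sub>R e) \<ge> t * (\<nu> \<bullet> e) + h1 s / (\<nu> \<bullet> e) / t)" by auto
    have "k2 s > ?G' s" if "0 \<le> s" "s \<le> L" for s using k2 that \<delta> by simp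
    from DN_upper_bound_at_chord_ends[OF op bounded cvx C2 ch q' k this]
    obtain T' where T': "T' > 0" "\<forall>t\<ge>T'. \<forall>g. has_DN_data \<Omega> q' (\<lambda>x. t * ell e b x) g \<longrightarrow>
      (\<forall>s\<in>{0, L}. \<forall>\<nu>. \<nu> = outward_unit_normal \<Omega> (p + s *\<^sub>R e) \<longrightarrow>
        g (p + s *\<^sub>R e) \<le> t * (\<nu> \<bullet> e) + k1 s / (\<nu> \<bullet> e) / t)" by auto
    define t where "t = max t0 (max T T')"
    have t: "t \<ge> t0" "t \<ge> T" "t \<ge> T'" "t > 0" using T(1) by (auto simp: t_def)
    obtain g where g: "has_DN_data \<Omega> q (\<lambda>x. t * ell e b x) g" "has_DN_data \<Omega> q' (\<lambda>x. t * ell e b x) g"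
      using DN[OF t(1)] by blast
    have cmp: "h1 s / (\<nu> \<bullet> e) \<le> k1 s / (\<nu> \<bullet> e)"
      if "s \<in> {0, L}" "\<nu> = outward_unit_normal \<Omega> (p + s *\<^sub>R e)" for s \<nu>
    proof -
      have "t * (\<nu> \<bullet> e) + h1 s / (\<nu> \<bullet> e) / t \<le> g (p + s *\<^sub>R e)" using T(2) t(2) g(1) that by blast
      also have "\<dots> \<le> t * (\<nu> \<bullet> e) + k1 s / (\<nu> \<bullet> e) / t" using T'(2) t(3) g(2) that by blast
      finally have "h1 s / (\<nu> \<bullet> e) / t \<le> k1 s / (\<nu> \<bullet> e) / t" by simp
      then show ?thesis using t(4) divide_le_cancel[of "h1 s / (\<nu> \<bullet> e)" t "k1 s / (\<nu> \<bullet> e)"] by blast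
    qed
    have "h1 0 \<ge> k1 0" "h1 L \<le> k1 L"
      using cmp[of 0] cmp[of L] chord_end_transversal[OF op cvx C2 ch] by (auto simp: divide_le_cancel)
    then have "integral {0..L} (\<lambda>s. ?G s - \<delta>) \<le> integral {0..L} (\<lambda>s. ?G' s + \<delta>)"
      using hI kI by linarith
    moreover have "integral {0..L} (\<lambda>s. ?G s - \<delta>) = integral {0..L} ?G - integral {0..L} (\<lambda>s. \<delta>)"
      by (intro Henstock_Kurzweil_Integration.integral_diff integrable_continuous_real G continuous_on_const)
    moreover have "integral {0..L} (\<lambda>s. ?G' s + \<delta>) = integral {0..L} ?G' + integral {0..L} (\<lambda>s. \<delta>)"
      by (intro Henstock_Kurzweil_Integration.integral_add integrable_continuous_real G continuous_on_const)
    moreover have "integral {0..L} (\<lambda>s. \<delta>) = \<delta> * L" using L by simp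
    moreover have "\<delta> * L = \<epsilon> / 2" using L by (simp add: \<delta>_def)
    ultimately show ?thesis by linarith
  qed
  then show ?thesis by (rule field_le_epsilon)
qed

section \<open>Vanishing line integrals and exponential moments\<close>

text \<open>
  Instead of choosing coordinates adapted to \<open>e\<close>, the function is multiplied by the translates along
  \<open>e\<close> of a slab indicator \<open>W\<close>. They integrate to \<open>1\<close> over the translation parameter, and after a
  shear the parameter runs along the line through a point of the slab.
\<close>

lemma integral_eq_0_if_line_integrals_eq_0:
  fixes F :: "'a :: euclidean_space \<Rightarrow> real" and e :: 'a
  assumes F [measurable]: "F \<in> borel_measurable borel"
    and B: "\<And>x. \<bar>F x\<bar> \<le> B" and R: "\<And>x. F x \<noteq> 0 \<Longrightarrow> norm x \<le> R"
    and e: "norm e = 1"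
    and lines: "\<And>x. (LINT s|lborel. F (x + s *\<^sub>R e)) = 0"
  shows "(LINT x|lborel. F x) = 0"
proof -
  define W :: "'a \<Rightarrow> real" where "W x = indicator {0..1} (e \<bullet> x)" for x
  have [measurable]: "W \<in> borel_measurable borel"
    unfolding W_def[abs_def] by measurable
  have W01: "0 \<le> W x" "W x \<le> 1" for x by (auto simp: W_def indicator_def)
  have comp: "\<bar>e \<bullet> x\<bar> \<le> norm x" for x using Cauchy_Schwarz_ineq2[of e x] e by simp
  have ee: "e \<bullet> e = 1" using e by (simp add: norm_eq_1)
  have integrableI: "integrable (lborel \<Otimes>\<^sub>M lborel) (case_prod H)"
    if H: "case_prod H \<in> borel_measurable (borel :: ('a \<times> real) measure)" and bnd: "\<And>x s. \<bar>H x s\<bar> \<le> B"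
      and supp: "\<And>x s. H x s \<noteq> 0 \<Longrightarrow> norm x \<le> r \<and> \<bar>s\<bar> \<le> r" for H :: "'a \<Rightarrow> real \<Rightarrow> real" and r
    unfolding lborel_prod
  proof (rule integrableI_bounded_set[where A = "cball 0 r \<times> {-r..r}" and B = B])
    show "emeasure lborel (cball (0::'a) r \<times> {-r..r}) < \<infinity>"
      by (intro emeasure_compact_finite compact_Times) auto
    show "cball (0::'a) r \<times> {-r..r} \<in> sets lborel"
      by (auto intro!: borel_closed closed_Times)
    show "case_prod H \<in> borel_measurable lborel" using H by simp
    show "AE x in lborel. x \<in> cball 0 r \<times> {-r..r} \<longrightarrow> norm (case_prod H x) \<le> B"
      using bnd by (auto simp: split_beta)
    have "case_prod H x = 0" if "x \<notin> cball 0 r \<times> {-r..r}" for x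
    proof (rule ccontr)
      assume "case_prod H x \<noteq> 0"
      with supp[of "fst x" "snd x"] that show False by (auto simp: abs_le_iff split_beta mem_Times_iff)
    qed
    then show "AE x in lborel. x \<notin> cball 0 r \<times> {-r..r} \<longrightarrow> case_prod H x = 0" by simp
  qed
  have absle: "\<bar>F x * W y\<bar> \<le> B" for x y
    using mult_mono[OF B[of x] W01(2)[of y]] B[of x] W01[of y] by (simp add: abs_mult)
  have shear [measurable]: "(\<lambda>(x, s). F (x + s *\<^sub>R e) * W x) \<in> borel_measurable (borel :: ('a \<times> real) measure)"
    "(\<lambda>(x, s). F x * W (x - s *\<^sub>R e)) \<in> borel_measurable (borel :: ('a \<times> real) measure)"
    unfolding borel_prod[symmetric] by measurable
  have int1: "integrable (lborel \<Otimes>\<^sub>M lborel) (\<lambda>(x, s). F x * W (x - s *\<^sub>R e))"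
  proof (rule integrableI[OF shear(2) absle])
    fix x s assume "F x * W (x - s *\<^sub>R e) \<noteq> 0"
    then have "norm x \<le> R" "0 \<le> e \<bullet> x - s" "e \<bullet> x - s \<le> 1"
      using R[of x] by (auto simp: W_def inner_diff_right ee split: split_indicator_asm)
    then show "norm x \<le> 2 * R + 1 \<and> \<bar>s\<bar> \<le> 2 * R + 1" using comp[of x] norm_ge_zero[of x] by linarith
  qed
  have int2: "integrable (lborel \<Otimes>\<^sub>M lborel) (\<lambda>(x, s). F (x + s *\<^sub>R e) * W x)"
  proof (rule integrableI[OF shear(1) absle])
    fix x s assume "F (x + s *\<^sub>R e) * W x \<noteq> 0"
    then have *: "norm (x + s *\<^sub>R e) \<le> R" "0 \<le> e \<bullet> x" "e \<bullet> x \<le> 1"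
      using R[of "x + s *\<^sub>R e"] by (auto simp: W_def split: split_indicator_asm)
    have s: "\<bar>s\<bar> \<le> R + 1"
      using comp[of "x + s *\<^sub>R e"] * by (simp add: inner_add_right ee abs_le_iff)
    have "norm x \<le> norm (x + s *\<^sub>R e) + norm (s *\<^sub>R e)"
      using norm_triangle_ineq4[of "x + s *\<^sub>R e" "s *\<^sub>R e"] by simp
    moreover have "0 \<le> R" using *(1) norm_ge_zero[of "x + s *\<^sub>R e"] by linarith
    ultimately show "norm x \<le> 2 * R + 1 \<and> \<bar>s\<bar> \<le> 2 * R + 1"
      using s *(1) e by simp
  qed
  have W1: "(LINT s|lborel. W (x - s *\<^sub>R e)) = 1" for x
  proof -
    have "W (x - s *\<^sub>R e) = indicator {e \<bullet> x - 1..e \<bullet> x} s" for s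
      by (auto simp: W_def inner_diff_right ee indicator_def)
    then show ?thesis by simp
  qed
  have "(LINT x|lborel. F x) = (LINT x|lborel. LINT s|lborel. F x * W (x - s *\<^sub>R e))"
    by (simp add: W1)
  also have "\<dots> = (LINT s|lborel. LINT x|lborel. F x * W (x - s *\<^sub>R e))"
    by (rule lborel_pair.Fubini_integral[OF int1, symmetric])
  also have "\<dots> = (LINT s|lborel. LINT x|lborel. F (x + s *\<^sub>R e) * W x)"
  proof (rule Bochner_Integration.integral_cong[OF refl])
    fix s
    have "(LINT x|lborel. F x * W (x - s *\<^sub>R e))
        = (LINT x|distr lborel borel ((+) (s *\<^sub>R e)). F x * W (x - s *\<^sub>R e))"
      by (simp add: lborel_distr_plus)
    also have "\<dots> = (LINT x|lborel. F (s *\<^sub>R e + x) * W (s *\<^sub>R e + x - s *\<^sub>R e))"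
      by (subst integral_distr) auto
    finally show "(LINT x|lborel. F x * W (x - s *\<^sub>R e)) = (LINT x|lborel. F (x + s *\<^sub>R e) * W x)"
      by (simp add: add.commute)
  qed
  also have "\<dots> = (LINT x|lborel. LINT s|lborel. F (x + s *\<^sub>R e) * W x)"
    by (rule lborel_pair.Fubini_integral[OF int2])
  also have "\<dots> = 0" by (simp add: lines)
  finally show ?thesis .
qed

lemma integrable_indicator_open_times:
  fixes f :: "'a :: euclidean_space \<Rightarrow> real"
  assumes "open \<Omega>" "bounded \<Omega>" "continuous_on (closure \<Omega>) f"
  shows "integrable lborel (\<lambda>x. indicator \<Omega> x * f x)"
proof -
  have "integrable lborel (\<lambda>x. indicator (closure \<Omega>) x *\<^sub>R f x)"
    using assms by (intro borel_integrable_compact) auto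
  then have "integrable lborel (\<lambda>x. indicator \<Omega> x *\<^sub>R (indicator (closure \<Omega>) x *\<^sub>R f x))"
    by (rule integrable_mult_indicator[rotated]) (use assms(1) in auto)
  moreover have "indicator \<Omega> x *\<^sub>R (indicator (closure \<Omega>) x *\<^sub>R f x) = indicator \<Omega> x * f x" for x
    using closure_subset[of \<Omega>] by (auto simp: indicator_def)
  ultimately show ?thesis by (simp only:)
qed

text \<open>
  Finite linear combinations of exponentials; they form an algebra because
  \<open>exp (w \<bullet> x) * exp (w' \<bullet> x) = exp ((w + w') \<bullet> x)\<close>.
\<close>

inductive_set exponential_sums :: "('a :: euclidean_space \<Rightarrow> real) set" where
  exponential: "(\<lambda>x. c * exp (w \<bullet> x)) \<in> exponential_sums"
| add: "f \<in> exponential_sums \<Longrightarrow> g \<in> exponential_sums \<Longrightarrow> (\<lambda>x. f x + g x) \<in> exponential_sums"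

lemma exponential_sums_continuous: "f \<in> exponential_sums \<Longrightarrow> continuous_on S f"
  by (induction rule: exponential_sums.induct) (auto intro!: continuous_intros)

lemma exponential_sums_mult:
  assumes f: "f \<in> exponential_sums" and g: "g \<in> exponential_sums"
  shows "(\<lambda>x. f x * g x) \<in> exponential_sums"
  using f
proof induction
  case (exponential c w)
  show ?case using g
  proof induction
    case (exponential c' w')
    have "(\<lambda>x. c * exp (w \<bullet> x) * (c' * exp (w' \<bullet> x))) = (\<lambda>x. (c * c') * exp ((w + w') \<bullet> x))"
      by (simp add: fun_eq_iff inner_add_left exp_add)
    then show ?case by (simp add: exponential_sums.exponential)
  next
    case (add f g)
    then show ?case using exponential_sums.add[OF add.IH] by (simp add: distrib_left)
  qed
next
  case (add f1 f2)
  show ?case using exponential_sums.add[OF add.IH] by (simp add: distrib_right)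
qed

lemma function_ring_exponential_sums:
  assumes "compact S" shows "function_ring_on exponential_sums S"
proof
  show "(\<lambda>_. c) \<in> exponential_sums" for c
    using exponential_sums.exponential[of c 0] by simp
  fix x y :: 'a assume "x \<noteq> y"
  then have "(x - y) \<bullet> x \<noteq> (x - y) \<bullet> y"
    by (metis inner_diff_right inner_eq_zero_iff right_minus_eq)
  then show "\<exists>f\<in>exponential_sums. f x \<noteq> f y"
    by (intro bexI[OF _ exponential_sums.exponential[of 1 "x - y"]]) simp
qed (use assms in \<open>auto intro: exponential_sums_continuous exponential_sums.add exponential_sums_mult\<close>)

text \<open>
  The function is orthogonal to all exponential sums, which approximate it uniformly on the closure of
  \<open>\<Omega>\<close>. So the integral of its square over \<open>\<Omega>\<close> is zero.
\<close>

lemma eq_0_if_exponential_moments_eq_0: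
  fixes p :: "'a :: euclidean_space \<Rightarrow> real"
  assumes op: "open \<Omega>" and bounded: "bounded \<Omega>" and p: "continuous_on (closure \<Omega>) p"
    and mom: "\<And>w. (LINT x|lborel. indicator \<Omega> x * (p x * exp (w \<bullet> x))) = 0"
    and "x \<in> \<Omega>"
  shows "p x = 0"
proof -
  have integrable: "integrable lborel (\<lambda>x. indicator \<Omega> x * f x)" if "continuous_on (closure \<Omega>) f" for f :: "'a \<Rightarrow> real"
    by (rule integrable_indicator_open_times[OF op bounded that])
  have orth: "(LINT x|lborel. indicator \<Omega> x * (p x * g x)) = 0" if "g \<in> exponential_sums" for g
    using that
  proof induction
    case (exponential c w)
    have "(LINT x|lborel. c * (indicator \<Omega> x * (p x * exp (w \<bullet> x)))) = 0" by (simp add: mom)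
    then show ?case by (simp add: mult_ac)
  next
    case (add f g)
    have "(LINT x|lborel. indicator \<Omega> x * (p x * f x) + indicator \<Omega> x * (p x * g x)) = 0"
      using add.IH by (subst Bochner_Integration.integral_add)
        (intro integrable continuous_on_mult p exponential_sums_continuous add.hyps | simp)+
    then show ?case by (simp add: algebra_simps)
  qed
  define J where "J = (LINT x|lborel. indicator \<Omega> x * (p x * p x))"
  define M where "M = (LINT x|lborel. indicator \<Omega> x * \<bar>p x\<bar>)"
  have "J \<le> \<epsilon> * M" if \<epsilon>: "\<epsilon> > 0" for \<epsilon>
  proof -
    interpret function_ring_on exponential_sums "closure \<Omega>"
      by (rule function_ring_exponential_sums) (use bounded in simp)
    obtain g where g: "g \<in> exponential_sums" "\<And>x. x \<in> closure \<Omega> \<Longrightarrow> \<bar>p x - g x\<bar> < \<epsilon>"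
      using Stone_Weierstrass_basic[OF p \<epsilon>] by blast
    have gc: "continuous_on (closure \<Omega>) g" by (rule exponential_sums_continuous[OF g(1)])
    have "J = (LINT x|lborel. indicator \<Omega> x * (p x * p x)) - (LINT x|lborel. indicator \<Omega> x * (p x * g x))"
      by (simp add: orth[OF g(1)] J_def)
    also have "\<dots> = (LINT x|lborel. indicator \<Omega> x * (p x * p x) - indicator \<Omega> x * (p x * g x))"
      by (rule Bochner_Integration.integral_diff[symmetric]) (intro integrable continuous_intros p gc)+
    also have "\<dots> \<le> (LINT x|lborel. \<epsilon> * (indicator \<Omega> x * \<bar>p x\<bar>))"
    proof (rule integral_mono)
      show "integrable lborel (\<lambda>x. indicator \<Omega> x * (p x * p x) - indicator \<Omega> x * (p x * g x))"
        by (intro Bochner_Integration.integrable_diff integrable continuous_intros p gc)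
      show "integrable lborel (\<lambda>x. \<epsilon> * (indicator \<Omega> x * \<bar>p x\<bar>))"
        by (intro integrable_mult_right integrable continuous_intros p)
      fix x
      have "p x * (p x - g x) \<le> \<bar>p x\<bar> * \<epsilon>" if "x \<in> \<Omega>"
      proof -
        have "p x * (p x - g x) \<le> \<bar>p x\<bar> * \<bar>p x - g x\<bar>" by (metis abs_ge_self abs_mult)
        also have "\<dots> \<le> \<bar>p x\<bar> * \<epsilon>"
          using g(2)[of x] that closure_subset[of \<Omega>] by (intro mult_left_mono) force+
        finally show ?thesis .
      qed
      then show "indicator \<Omega> x * (p x * p x) - indicator \<Omega> x * (p x * g x) \<le> \<epsilon> * (indicator \<Omega> x * \<bar>p x\<bar>)"
        by (cases "x \<in> \<Omega>") (auto simp: algebra_simps)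
    qed
    also have "\<dots> = \<epsilon> * M" by (simp add: M_def)
    finally show ?thesis .
  qed note J_le = this
  have "M \<ge> 0" unfolding M_def by (rule integral_nonneg_AE) auto
  have "J \<le> 0 + \<epsilon>" if "\<epsilon> > 0" for \<epsilon>
  proof -
    have "J \<le> (\<epsilon> / (M + 1)) * M" by (rule J_le) (use \<open>M \<ge> 0\<close> that in simp)
    also have "\<dots> \<le> \<epsilon>" using \<open>M \<ge> 0\<close> that by (simp add: field_simps)
    finally show ?thesis by simp
  qed
  then have "J \<le> 0" by (rule field_le_epsilon)
  moreover have "J \<ge> 0" unfolding J_def by (rule integral_nonneg_AE) auto
  ultimately have J0: "(LINT x|lborel. indicator \<Omega> x * (p x * p x)) = 0" unfolding J_def by simp
  have "AE x in lborel. indicator \<Omega> x * (p x * p x) = 0"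
    using J0 integrable[of "\<lambda>x. p x * p x"]
    by (subst (asm) integral_nonneg_eq_0_iff_AE) (auto intro!: continuous_intros p)
  then have ae: "AE x in lborel. x \<notin> \<Omega> \<inter> p -` (- {0})"
    by eventually_elim (auto simp: indicator_def)
  have U: "open (\<Omega> \<inter> p -` (- {0}))"
    by (rule continuous_open_preimage[OF continuous_on_subset[OF p closure_subset] op]) auto
  then have "\<Omega> \<inter> p -` (- {0}) \<in> null_sets lborel"
    using ae by (subst AE_iff_null_sets) auto
  then have "negligible (\<Omega> \<inter> p -` (- {0}))"
    by (simp add: negligible_iff_null_sets null_sets_completionI)
  then have "\<Omega> \<inter> p -` (- {0}) = {}" using open_not_negligible[OF U] by blast
  then show ?thesis using \<open>x \<in> \<Omega>\<close> by auto
qed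

section \<open>From chords to the potential\<close>

lemma line_integral_eq_chord_integral:
  fixes \<Omega> :: "(real ^ 'n) set" and f :: "real ^ 'n \<Rightarrow> real"
  assumes op: "open \<Omega>" and bounded: "bounded \<Omega>" and cvx: "convex \<Omega>"
    and f: "continuous_on (closure \<Omega>) f" and e: "norm e = 1"
    and chords: "\<And>p L. is_chord \<Omega> p e L \<Longrightarrow> integral {0..L} (\<lambda>s. f (p + s *\<^sub>R e)) = 0"
  shows "(LINT s|lborel. indicator \<Omega> (x + s *\<^sub>R e) * f (x + s *\<^sub>R e)) = 0"
proof (cases "\<exists>s. x + s *\<^sub>R e \<in> \<Omega>")
  case False
  then show ?thesis by simp
next
  case True
  then obtain s0 where "x + s0 *\<^sub>R e \<in> \<Omega>" by blast
  then obtain p L s1 where ch: "is_chord \<Omega> p e L" and "x + s0 *\<^sub>R e = p + s1 *\<^sub>R e"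
    using chord_through[OF op bounded _ e] by metis
  then have x: "x = p + (s1 - s0) *\<^sub>R e"
    by (simp add: algebra_simps)
  have L: "L > 0" using ch by (simp add: is_chord_def)
  have "p \<notin> \<Omega>" "p + L *\<^sub>R e \<notin> \<Omega>" using ch op by (auto simp: is_chord_def frontier_def interior_open)
  then have mem: "p + s *\<^sub>R e \<in> \<Omega> \<longleftrightarrow> s \<in> {0<..<L}" for s
    using ch chord_closure[OF op cvx ch, of s] closure_subset[of \<Omega>]
    unfolding is_chord_def by (cases "s = 0"; cases "s = L") fastforce+
  have cont: "continuous_on {0..L} (\<lambda>s. f (p + s *\<^sub>R e))"
    by (intro continuous_on_compose2[OF f] continuous_intros) (use chord_subset_closure[OF ch] in auto)
  then have "set_integrable lborel {0..L} (\<lambda>s. f (p + s *\<^sub>R e))"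
    by (rule borel_integrable_atLeastAtMost')
  then have int: "set_integrable lborel {0<..<L} (\<lambda>s. f (p + s *\<^sub>R e))"
    by (rule set_integrable_subset) auto
  have "(LINT s|lborel. indicator \<Omega> (x + s *\<^sub>R e) * f (x + s *\<^sub>R e))
      = (LINT s|lborel. indicator {0<..<L} (s1 - s0 + 1 * s) * f (p + (s1 - s0 + 1 * s) *\<^sub>R e))"
  proof (rule Bochner_Integration.integral_cong[OF refl])
    fix s
    have "x + s *\<^sub>R e = p + (s1 - s0 + 1 * s) *\<^sub>R e" by (simp add: x algebra_simps)
    then show "indicator \<Omega> (x + s *\<^sub>R e) * f (x + s *\<^sub>R e)
        = indicator {0<..<L} (s1 - s0 + 1 * s) * f (p + (s1 - s0 + 1 * s) *\<^sub>R e)"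
      using mem[of "s1 - s0 + 1 * s"] by (simp add: indicator_def)
  qed
  also have "\<dots> = (LINT s|lborel. indicator {0<..<L} s * f (p + s *\<^sub>R e))"
    using lborel_integral_real_affine[of 1 "\<lambda>s. indicator {0<..<L} s * f (p + s *\<^sub>R e)" "s1 - s0"] by simp
  also have "\<dots> = (LINT s:{0<..<L}|lborel. f (p + s *\<^sub>R e))"
    by (simp add: set_lebesgue_integral_def)
  also have "\<dots> = integral {0<..<L} (\<lambda>s. f (p + s *\<^sub>R e))"
    by (rule set_borel_integral_eq_integral(2)[OF int])
  also have "\<dots> = integral {0..L} (\<lambda>s. f (p + s *\<^sub>R e))"
    by (simp add: integral_open_interval_real)
  finally show ?thesis using chords[OF ch] by simp
qed

text \<open>
  As \<open>w\<close> is orthogonal to \<open>e\<close>, the exponential is constant on every line in direction \<open>e\<close> and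
  leaves the integrals over these lines zero.
\<close>

lemma exponential_moment_eq_0:
  fixes \<Omega> :: "(real ^ 'n) set" and f :: "real ^ 'n \<Rightarrow> real"
  assumes op: "open \<Omega>" and bounded: "bounded \<Omega>" and cvx: "convex \<Omega>"
    and f: "continuous_on (closure \<Omega>) f" and e: "norm e = 1" and w: "w \<bullet> e = 0"
    and chords: "\<And>p L. is_chord \<Omega> p e L \<Longrightarrow> integral {0..L} (\<lambda>s. f (p + s *\<^sub>R e)) = 0"
  shows "(LINT x|lborel. indicator \<Omega> x * (f x * exp (w \<bullet> x))) = 0"
proof -
  define F where "F x = f x * exp (w \<bullet> x)" for x
  have F: "continuous_on (closure \<Omega>) F"
    unfolding F_def by (intro continuous_intros f)
  have chF: "integral {0..L} (\<lambda>s. F (p + s *\<^sub>R e)) = 0" if "is_chord \<Omega> p e L" for p L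
    using chords[OF that] by (simp add: F_def inner_add_right w)
  obtain B where B: "\<And>x. x \<in> closure \<Omega> \<Longrightarrow> \<bar>F x\<bar> \<le> B"
    using compact_imp_bounded[OF compact_continuous_image[OF F]] bounded by (auto simp: bounded_iff)
  obtain R where R: "\<And>x. x \<in> \<Omega> \<Longrightarrow> norm x \<le> R"
    using bounded by (auto simp: bounded_iff)
  have "(LINT x|lborel. indicator \<Omega> x * F x) = 0"
  proof (rule integral_eq_0_if_line_integrals_eq_0[where B = "\<bar>B\<bar>" and R = R, OF _ _ _ e])
    have "(\<lambda>x. indicator \<Omega> x *\<^sub>R F x) \<in> borel_measurable borel"
      using op by (intro borel_measurable_continuous_on_indicator continuous_on_subset[OF F closure_subset]) auto
    then show "(\<lambda>x. indicator \<Omega> x * F x) \<in> borel_measurable borel" by simp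
    show "\<bar>indicator \<Omega> x * F x\<bar> \<le> \<bar>B\<bar>" for x
      using B[of x] closure_subset[of \<Omega>] by (force simp: indicator_def)
    show "norm x \<le> R" if "indicator \<Omega> x * F x \<noteq> 0" for x
      using that R by (auto simp: indicator_def split: if_splits)
    show "(LINT s|lborel. indicator \<Omega> (x + s *\<^sub>R e) * F (x + s *\<^sub>R e)) = 0" for x
      by (rule line_integral_eq_chord_integral[OF op bounded cvx F e chF])
  qed
  then show ?thesis by (simp add: F_def)
qed

theorem theorem1p2:
  fixes \<Omega> :: "(real ^ 'n) set"
    and q\<^sub>1 q\<^sub>2 :: "real ^ 'n \<Rightarrow> real"
    and c\<^sub>0 b :: real
  assumes "CARD('n) \<ge> 2"
    and "open \<Omega>" and "\<Omega> \<noteq> {}" and "bounded \<Omega>" and "convex \<Omega>" and "C2_boundary \<Omega>"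
    and "C2_closure \<Omega> q\<^sub>1" and "C2_closure \<Omega> q\<^sub>2"
    and "c\<^sub>0 > 0"
    and "\<forall>x\<in>closure \<Omega>. q\<^sub>1 x \<ge> c\<^sub>0" and "\<forall>x\<in>closure \<Omega>. q\<^sub>2 x \<ge> c\<^sub>0"
    and "b > (SUP x\<in>closure \<Omega>. norm x)"
    and "\<forall>e\<in>sphere 0 1. \<exists>t\<^sub>e>0. \<forall>t\<ge>t\<^sub>e. \<exists>g.
           has_DN_data \<Omega> q\<^sub>1 (\<lambda>x. t * ell e b x) g \<and>
           has_DN_data \<Omega> q\<^sub>2 (\<lambda>x. t * ell e b x) g"
  shows "\<forall>x\<in>\<Omega>. q\<^sub>1 x = q\<^sub>2 x"
proof -
  note op = assms(2) and bounded = assms(4) and cvx = assms(5) and C2 = assms(6)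
  have q: "continuous_on (closure \<Omega>) q\<^sub>1" "continuous_on (closure \<Omega>) q\<^sub>2"
    using assms(7,8) by (auto simp: C2_closure_def)
  have pos: "q\<^sub>1 x > 0" "q\<^sub>2 x > 0" if "x \<in> \<Omega>" for x
    using assms(9-11) that closure_subset[of \<Omega>] by force+
  have "b > 0"
  proof -
    obtain x where "x \<in> \<Omega>" using assms(3) by blast
    have "bdd_above (norm ` closure \<Omega>)"
      using bounded_closure[OF bounded] by (simp add: bdd_above_norm)
    then have "norm x \<le> (SUP x\<in>closure \<Omega>. norm x)"
      using \<open>x \<in> \<Omega>\<close> closure_subset[of \<Omega>] by (intro cSUP_upper) auto
    then show ?thesis using assms(12) norm_ge_zero[of x] by linarith
  qed
  define p where "p x = q\<^sub>1 x - q\<^sub>2 x" for x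
  have p: "continuous_on (closure \<Omega>) p"
    unfolding p_def by (intro continuous_intros q)
  have ell_cont: "continuous_on (closure \<Omega>) (ell e b)" for e
    unfolding ell_def by (intro continuous_intros)
  have chords: "integral {0..L} (\<lambda>s. p (y + s *\<^sub>R e) * ell e b (y + s *\<^sub>R e)) = 0"
    if e: "norm e = 1" and ch: "is_chord \<Omega> y e L" for e y L
  proof -
    have "e \<in> sphere 0 1" using e by simp
    then obtain t0 where DN: "\<And>t. t \<ge> t0 \<Longrightarrow> \<exists>g. has_DN_data \<Omega> q\<^sub>1 (\<lambda>x. t * ell e b x) g \<and>
           has_DN_data \<Omega> q\<^sub>2 (\<lambda>x. t * ell e b x) g"
      using assms(13) by blast
    then have DN': "\<And>t. t \<ge> t0 \<Longrightarrow> \<exists>g. has_DN_data \<Omega> q\<^sub>2 (\<lambda>x. t * ell e b x) g \<and>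
           has_DN_data \<Omega> q\<^sub>1 (\<lambda>x. t * ell e b x) g" by blast
    have "continuous_on {0..L} (\<lambda>s. f (y + s *\<^sub>R e) * ell e b (y + s *\<^sub>R e))"
      if "continuous_on (closure \<Omega>) f" for f :: "real ^ 'n \<Rightarrow> real"
      by (intro continuous_intros continuous_on_compose2[OF that] continuous_on_compose2[OF ell_cont])
        (use chord_subset_closure[OF ch] in auto)
    note int = integrable_continuous_real[OF this[OF q(1)]] integrable_continuous_real[OF this[OF q(2)]]
    have "integral {0..L} (\<lambda>s. q\<^sub>1 (y + s *\<^sub>R e) * ell e b (y + s *\<^sub>R e))
        = integral {0..L} (\<lambda>s. q\<^sub>2 (y + s *\<^sub>R e) * ell e b (y + s *\<^sub>R e))"
      by (intro antisym chord_integral_le[OF op bounded cvx C2 ch q(1) pos(1) q(2) pos(2) DN]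
          chord_integral_le[OF op bounded cvx C2 ch q(2) pos(2) q(1) pos(1) DN'])
    then show ?thesis
      using Henstock_Kurzweil_Integration.integral_diff[OF int] by (simp add: p_def left_diff_distrib)
  qed
  have "(LINT x|lborel. indicator \<Omega> x * (p x * exp (w \<bullet> x))) = 0" for w :: "real ^ 'n"
  proof -
    \<comment> \<open>This is where the dimension has to be at least two.\<close>
    obtain v :: "real ^ 'n" where v: "v \<noteq> 0" "orthogonal w v"
      using orthogonal_to_vector_exists[of w] assms(1) by auto
    define e where "e = v /\<^sub>R norm v"
    have e: "norm e = 1" "w \<bullet> e = 0" "norm (- e) = 1" "w \<bullet> (- e) = 0"
      using v by (simp_all add: e_def orthogonal_def)
    let ?I = "\<lambda>d x. indicator \<Omega> x * (p x * ell d b x * exp (w \<bullet> x))"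
    have I_0: "(LINT x|lborel. ?I d x) = 0" if d: "norm d = 1" "w \<bullet> d = 0" for d
      by (rule exponential_moment_eq_0[OF op bounded cvx _ d chords[OF d(1)]])
        (intro continuous_intros p ell_cont)
    have "(LINT x|lborel. ?I e x) = 0" "(LINT x|lborel. ?I (- e) x) = 0"
      using I_0[OF e(1,2)] I_0[OF e(3,4)] .
    moreover have "integrable lborel (?I d)" for d
      by (intro integrable_indicator_open_times[OF op bounded] continuous_intros p ell_cont)
    ultimately have "(LINT x|lborel. ?I e x + ?I (- e) x) = 0"
      by (subst Bochner_Integration.integral_add) auto
    also have "(\<lambda>x. ?I e x + ?I (- e) x) = (\<lambda>x. (2 * b) * (indicator \<Omega> x * (p x * exp (w \<bullet> x))))"
      by (simp add: fun_eq_iff ell_def algebra_simps)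
    finally show ?thesis using \<open>b > 0\<close> by simp
  qed
  then have "p x = 0" if "x \<in> \<Omega>" for x
    using eq_0_if_exponential_moments_eq_0[OF op bounded p _ that] by blast
  then show ?thesis by (simp add: p_def)
qed

end
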